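(* Let $\alpha\in\mathbb{R}\setminus\mathbb{Q}$ and let $R_\alpha:\mathbb{S}^1\to\mathbb{S}^1$, $x\mapsto x+\alpha$, be the corresponding irrational rotation of the circle $\mathbb{S}^1=\mathbb{R}/\mathbb{Z}$, with Lebesgue measure $\mathrm{Leb}$. Then there exists a uniquely ergodic minimal homeomorphism $f$ of the two-torus $\mathbb{T}^2$, with invariant probability measure $\mu$, such that the measured dynamical system $(\mathbb{T}^2,\mu,f)$ is isomorphic to $(\mathbb{S}^1,\mathrm{Leb},R_\alpha)$.
   Context: A measured dynamical system $(X,\mu,R)$ consists of a probability space $(X,\mu)$ and a bi-measurable bijection $R:X\to X$ for which $\mu$ is invariant. Two systems $(X,\mu,R)$ and $(Y,\nu,S)$ are isomorphic if there are full measure subsets $X_0\subset X$, $Y_0\subset Y$ and a bijective bi-measurable map $\Phi:Y_0\to X_0$ which sends $\nu$ to $\mu$ and satisfies $\Phi S=R\Phi$ on $Y_0$. Topological spaces are equipped with their Borel $\sigma$-algebra. A homeomorphism is minimal if all its orbits are dense, and uniquely ergodic if it has a unique invariant probability measure. *)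

theory Defs
  imports "HOL-Probability.Probability"
begin

quotient_type circle = real / "\<lambda>x y :: real. x - y \<in> \<int>"
  morphisms rep_circle circle_of
proof (rule equivpI)
  show "reflp (\<lambda>x y :: real. x - y \<in> \<int>)"
    by (simp add: reflp_def)
  show "symp (\<lambda>x y :: real. x - y \<in> \<int>)"
  proof (rule sympI)
    fix x y :: real
    assume "x - y \<in> \<int>"
    then have "- (x - y) \<in> \<int>"
      by (rule Ints_minus)
    then show "y - x \<in> \<int>"
      by (simp only: minus_diff_eq)
  qed
  show "transp (\<lambda>x y :: real. x - y \<in> \<int>)"
  proof (rule transpI)
    fix x y z :: real
    assume "x - y \<in> \<int>" "y - z \<in> \<int>"
    then have "(x - y) + (y - z) \<in> \<int>"
      by (rule Ints_add)
    then show "x - z \<in> \<int>"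
      by simp
  qed
qed

instantiation circle :: topological_space
begin

definition open_circle :: "circle set \<Rightarrow> bool" where
  "open_circle U \<longleftrightarrow> open (circle_of -` U)"

instance
proof
  show "open (UNIV :: circle set)"
    by (simp add: open_circle_def)
  show "open (S \<inter> T)" if "open S" "open T" for S T :: "circle set"
    using that unfolding open_circle_def vimage_Int by (rule open_Int)
  show "open (\<Union>K)" if "\<forall>S\<in>K. open S" for K :: "circle set set"
    using that unfolding open_circle_def vimage_Union by (rule open_UN)
qed

end

type_synonym torus = "circle \<times> circle"

lift_definition rotation :: "real \<Rightarrow> circle \<Rightarrow> circle" is "\<lambda>\<alpha> x. x + \<alpha>"
  by simp

lemma continuous_on_circle_of: "continuous_on A circle_of"
proof (rule continuous_on_subset)
  show "continuous_on UNIV circle_of"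
    unfolding continuous_on_open_vimage[OF open_UNIV] open_circle_def by simp
qed simp

text \<open>Lebesgue measure on the circle: the image of Lebesgue measure on the fundamental
  domain \<open>[0,1)\<close>.\<close>

definition circle_leb :: "circle measure" where
  "circle_leb = distr (restrict_space lborel {0..<1}) borel circle_of"

lemma measurable_circle_of: "circle_of \<in> measurable (restrict_space lborel {0..<1}) borel"
  by (intro measurable_restrict_space1)
    (simp add: borel_measurable_continuous_onI continuous_on_circle_of)

definition measured_system :: "'a measure \<Rightarrow> ('a \<Rightarrow> 'a) \<Rightarrow> bool" where
  "measured_system M R \<longleftrightarrow>
     prob_space M \<and>
     bij_betw R (space M) (space M) \<and>
     R \<in> measurable M M \<and>
     the_inv_into (space M) R \<in> measurable M M \<and>
     distr M M R = M"

text \<open>The equation \<open>\<Phi> \<circ> S = R \<circ> \<Phi>\<close> on \<open>Y\<^sub>0\<close> presupposes that \<open>S\<close> maps \<open>Y\<^sub>0\<close> into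
  itself, since \<open>\<Phi>\<close> is only meaningful on \<open>Y\<^sub>0\<close>; as functions are total here, this is
  stated explicitly.\<close>

definition isomorphic_systems ::
    "'a measure \<Rightarrow> ('a \<Rightarrow> 'a) \<Rightarrow> 'b measure \<Rightarrow> ('b \<Rightarrow> 'b) \<Rightarrow> bool" where
  "isomorphic_systems M R N S \<longleftrightarrow>
     measured_system M R \<and> measured_system N S \<and>
     (\<exists>X\<^sub>0 Y\<^sub>0 \<Phi>.
        X\<^sub>0 \<in> sets M \<and> emeasure M X\<^sub>0 = 1 \<and>
        Y\<^sub>0 \<in> sets N \<and> emeasure N Y\<^sub>0 = 1 \<and>
        bij_betw \<Phi> Y\<^sub>0 X\<^sub>0 \<and>
        \<Phi> \<in> measurable (restrict_space N Y\<^sub>0) (restrict_space M X\<^sub>0) \<and>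
        the_inv_into Y\<^sub>0 \<Phi> \<in> measurable (restrict_space M X\<^sub>0) (restrict_space N Y\<^sub>0) \<and>
        distr (restrict_space N Y\<^sub>0) (restrict_space M X\<^sub>0) \<Phi> = restrict_space M X\<^sub>0 \<and>
        (\<forall>y\<in>Y\<^sub>0. S y \<in> Y\<^sub>0 \<and> \<Phi> (S y) = R (\<Phi> y)))"

definition full_orbit :: "('a \<Rightarrow> 'a) \<Rightarrow> 'a \<Rightarrow> 'a set" where
  "full_orbit f x = range (\<lambda>n. (f ^^ n) x) \<union> range (\<lambda>n. (inv f ^^ n) x)"

definition minimal_homeomorphism :: "('a::topological_space \<Rightarrow> 'a) \<Rightarrow> bool" where
  "minimal_homeomorphism f \<longleftrightarrow>
     (\<exists>g. homeomorphism UNIV UNIV f g) \<and> (\<forall>x. closure (full_orbit f x) = UNIV)"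

definition invariant_prob :: "('a::topological_space \<Rightarrow> 'a) \<Rightarrow> 'a measure \<Rightarrow> bool" where
  "invariant_prob f \<mu> \<longleftrightarrow>
     prob_space \<mu> \<and> sets \<mu> = sets borel \<and> f \<in> measurable \<mu> \<mu> \<and> distr \<mu> \<mu> f = \<mu>"

definition uniquely_ergodic :: "('a::topological_space \<Rightarrow> 'a) \<Rightarrow> bool" where
  "uniquely_ergodic f \<longleftrightarrow> (\<exists>!\<mu>. invariant_prob f \<mu>)"

end

theory Submission
  imports Defs "HOL-Analysis.Kronecker_Approximation_Theorem"
begin

text \<open>
  Write \<open>R(x, y) = (x + \<alpha>, y)\<close>. The homeomorphism \<open>f\<close> is a uniform limit of conjugates
  \<open>f\<^sub>n = G\<^sub>n R G\<^sub>n\<inverse>\<close>, where each \<open>G\<^sub>n\<close> preserves the vertical circles \<open>{x} \<times> S\<^sup>1\<close>. All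
  invariant probabilities of \<open>f\<close> turn out to sit on one measurable graph over the base, the image
  of a map \<open>\<gamma>\<close> with \<open>\<gamma>(x) \<in> {x} \<times> S\<^sup>1\<close>. As \<open>f\<close> acts on the base by the irrational rotation, they
  all project to Lebesgue measure; hence there is only one of them, and the projection to the base
  is an isomorphism with the rotation.

  The conjugacies are built by the method of Anosov and Katok in the fibred setting of Glasner and
  Weiss: \<open>G\<^sub>n\<^sub>+\<^sub>1 = G\<^sub>n K\<close> with \<open>K(x, y) = (x, A(y + q x))\<close>. Here \<open>A\<close> is a circle homeomorphism
  that sends everything outside a very short arc very close to \<open>0\<close>. One computes
  \<open>K R K\<inverse>(x, y) = (x + \<alpha>, A(A\<inverse>(y) + q \<alpha>))\<close>, so that after \<open>A\<close> has been chosen, taking \<open>q\<close> with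
  \<open>q \<alpha>\<close> close to an integer makes \<open>f\<^sub>n\<^sub>+\<^sub>1\<close> as close to \<open>f\<^sub>n\<close> as desired. The invariant curves
  of \<open>f\<^sub>n\<^sub>+\<^sub>1\<close> are the images under \<open>G\<^sub>n\<close> of the curves \<open>x \<mapsto> (x, A(c + q x))\<close>. Such a curve is
  dense up to \<open>1/q\<close>, yet over most of the base it stays in a thin strip around the
  zero section. The first property yields minimality of the limit. For the second, let \<open>U\<^sub>n\<close> be
  the image of the strip under \<open>G\<^sub>n\<close>: its fibres have diameter at most \<open>2\<^sup>-\<^sup>n\<close>, and there are many
  times among which every orbit of \<open>f\<^sub>n\<^sub>+\<^sub>1\<close> is outside \<open>U\<^sub>n\<close> at most once. Both properties involve
  only finitely many iterates, hence survive small perturbations and pass to \<open>f\<close>; the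
  second then says that every \<open>f\<close>-invariant probability gives mass at most \<open>2\<^sup>-\<^sup>n\<close> to the complement
  of \<open>U\<^sub>n\<close>. This is one step of the induction, lemma \<open>twist_step\<close>.

  By Borel and Cantelli almost every point, for any \<open>f\<close>-invariant probability, lies in all but
  finitely many \<open>U\<^sub>n\<close>, and in each fibre at most one point can do so. The same estimate, applied
  to \<open>f\<^sub>n\<^sub>+\<^sub>1\<close> and its invariant measure on the curve \<open>x \<mapsto> G\<^sub>n\<^sub>+\<^sub>1(x, 0)\<close>, shows that these curves
  converge almost everywhere; the limit is the graph \<open>\<gamma>\<close>.
\<close>

section \<open>The circle as a compact metric group\<close>

text \<open>Distance to the nearest integer. It induces the translation-invariant metric of the
  circle.\<close>

definition int_dist :: "real \<Rightarrow> real" where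
  "int_dist x = \<bar>x - of_int (round x)\<bar>"

lemma int_dist_le: "int_dist x \<le> \<bar>x - of_int n\<bar>"
  by (simp add: int_dist_def round_diff_minimal)

lemma int_dist_le_abs: "int_dist x \<le> \<bar>x\<bar>"
  using int_dist_le[of x 0] by simp

lemma int_dist_nonneg [simp]: "0 \<le> int_dist x"
  by (simp add: int_dist_def)

lemma int_dist_minus: "int_dist (- x) = int_dist x"
proof -
  have "int_dist (- y) \<le> int_dist y" for y
    using int_dist_le[of "- y" "- round y"] by (simp add: int_dist_def)
  from this[of x] this[of "- x"] show ?thesis by simp
qed

lemma int_dist_add: "int_dist (x + y) \<le> int_dist x + int_dist y"
  using int_dist_le[of "x + y" "round x + round y"] by (simp add: int_dist_def)

lemma int_dist_eq_0_iff: "int_dist x = 0 \<longleftrightarrow> x \<in> \<int>"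
proof
  assume "int_dist x = 0"
  then have "x = of_int (round x)" by (simp add: int_dist_def)
  then show "x \<in> \<int>" by (metis Ints_of_int)
next
  assume "x \<in> \<int>"
  then obtain n where "x = of_int n" by (elim Ints_cases)
  then show "int_dist x = 0"
    using int_dist_le[of x n] int_dist_nonneg[of x] by (simp del: int_dist_nonneg)
qed

lemma int_dist_cong:
  assumes "x - y \<in> \<int>"
  shows "int_dist x = int_dist y"
  using int_dist_add[of y "x - y"] int_dist_add[of x "- (x - y)"] assms
    int_dist_eq_0_iff[of "x - y"] int_dist_minus[of "x - y"] by simp

instantiation circle :: ab_group_add
begin

lift_definition zero_circle :: circle is 0 .

lift_definition plus_circle :: "circle \<Rightarrow> circle \<Rightarrow> circle" is "(+)"
  by (metis Ints_add add_diff_add)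

lift_definition uminus_circle :: "circle \<Rightarrow> circle" is uminus
  by (metis Ints_minus minus_diff_eq minus_diff_minus)

definition minus_circle :: "circle \<Rightarrow> circle \<Rightarrow> circle" where
  "minus_circle x y = x + (- y)"

instance
proof
  fix a b c :: circle
  show "a + b + c = a + (b + c)" by transfer (simp add: algebra_simps)
  show "a + b = b + a" by transfer (simp add: algebra_simps)
  show "0 + a = a" by transfer simp
  show "- a + a = 0" by transfer simp
  show "a - b = a + - b" by (rule minus_circle_def)
qed

end

lemma circle_of_0: "circle_of 0 = 0"
  by (simp add: zero_circle_def)

lemma circle_of_add: "circle_of (x + y) = circle_of x + circle_of y"
  by (simp add: plus_circle.abs_eq)

lemma circle_of_minus: "circle_of (- x) = - circle_of x"
  by (simp add: uminus_circle.abs_eq)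

lemma circle_of_diff: "circle_of (x - y) = circle_of x - circle_of y"
  using circle_of_add[of x "- y"] by (simp add: circle_of_minus)

lemma rotation_eq: "rotation \<alpha> x = x + circle_of \<alpha>"
  by transfer simp

lemma circle_cases [case_names circle_of]:
  obtains t where "x = circle_of t" "0 \<le> t" "t < 1"
proof -
  obtain s where s: "x = circle_of s"
    by (metis Quotient3_abs_rep Quotient3_circle)
  have "circle_of (frac s) = circle_of s"
    by (simp add: circle.abs_eq_iff frac_def)
  then show ?thesis
    using that[of "frac s"] s by (simp add: frac_ge_0 frac_lt_1)
qed

lift_definition circle_norm :: "circle \<Rightarrow> real" is int_dist
  by (rule int_dist_cong)

lemma circle_norm_of: "circle_norm (circle_of x) = int_dist x"
  by (rule circle_norm.abs_eq)

instantiation circle :: metric_space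
begin

definition dist_circle :: "circle \<Rightarrow> circle \<Rightarrow> real" where
  "dist_circle x y = circle_norm (x - y)"

definition uniformity_circle :: "(circle \<times> circle) filter" where
  "uniformity_circle = (INF e\<in>{0<..}. principal {(x, y). dist x y < e})"

lemma dist_circle_of: "dist (circle_of x) (circle_of y) = int_dist (x - y)"
  by (simp add: dist_circle_def circle_norm_of flip: circle_of_diff)

lemma dist_circle_of_le: "dist (circle_of x) (circle_of y) \<le> \<bar>x - y\<bar>"
  by (simp add: dist_circle_of int_dist_le_abs)

lemma dist_circle_representative:
  obtains t where "y = circle_of t" "dist (circle_of s) y = \<bar>s - t\<bar>"
proof -
  obtain u where u: "y = circle_of u" by (metis circle_cases)
  have "circle_of (u + of_int (round (s - u))) = y"
    by (simp add: u circle.abs_eq_iff)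
  moreover have "dist (circle_of s) y = \<bar>s - (u + of_int (round (s - u)))\<bar>"
    by (simp add: u dist_circle_of int_dist_def algebra_simps)
  ultimately show ?thesis using that by metis
qed

text \<open>The quotient topology is the metric topology: a metric ball around \<open>circle_of s\<close> is the
  image of the interval of the same radius around \<open>s\<close>.\<close>

lemma open_circle_iff_dist: "open U \<longleftrightarrow> (\<forall>x\<in>U. \<exists>e>0. \<forall>y. dist x y < e \<longrightarrow> y \<in> U)"
  for U :: "circle set"
proof
  assume "open U"
  then have op: "open (circle_of -` U)" by (simp add: open_circle_def)
  show "\<forall>x\<in>U. \<exists>e>0. \<forall>y. dist x y < e \<longrightarrow> y \<in> U"
  proof
    fix x assume "x \<in> U"
    obtain s where s: "x = circle_of s" by (metis circle_cases)
    then obtain e where e: "e > 0" "\<And>t. dist t s < e \<Longrightarrow> t \<in> circle_of -` U"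
      using op \<open>x \<in> U\<close> unfolding open_dist by blast
    have "y \<in> U" if "dist x y < e" for y
    proof -
      obtain t where "y = circle_of t" "dist (circle_of s) y = \<bar>s - t\<bar>"
        by (rule dist_circle_representative)
      then show ?thesis using that e(2)[of t] s by (simp add: dist_real_def)
    qed
    then show "\<exists>e>0. \<forall>y. dist x y < e \<longrightarrow> y \<in> U" using e(1) by blast
  qed
next
  assume U: "\<forall>x\<in>U. \<exists>e>0. \<forall>y. dist x y < e \<longrightarrow> y \<in> U"
  show "open U"
    unfolding open_circle_def open_dist
  proof
    fix s assume "s \<in> circle_of -` U"
    then obtain e where e: "e > 0" "\<And>y. dist (circle_of s) y < e \<Longrightarrow> y \<in> U"
      using U by auto
    have "t \<in> circle_of -` U" if "dist t s < e" for t
      using e(2)[of "circle_of t"] that dist_circle_of_le[of s t]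
      by (auto simp: dist_real_def)
    then show "\<exists>e>0. \<forall>t. dist t s < e \<longrightarrow> t \<in> circle_of -` U" using e(1) by blast
  qed
qed

instance
proof
  show uni: "uniformity = (INF e\<in>{0<..}. principal {(x :: circle, y). dist x y < e})"
    by (rule uniformity_circle_def)
  show "dist x y = 0 \<longleftrightarrow> x = y" for x y :: circle
    by (cases x rule: circle_cases; cases y rule: circle_cases)
      (simp add: dist_circle_of int_dist_eq_0_iff circle.abs_eq_iff)
  show "dist x y \<le> dist x z + dist y z" for x y z :: circle
  proof -
    obtain s where s: "x = circle_of s" by (metis circle_cases)
    obtain t where t: "y = circle_of t" by (metis circle_cases)
    obtain u where u: "z = circle_of u" by (metis circle_cases)
    show ?thesis
      unfolding s t u dist_circle_of
      using int_dist_add[of "s - u" "u - t"] int_dist_minus[of "t - u"] by simp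
  qed
  have comm: "dist x y = dist y x" for x y :: circle
    by (cases x rule: circle_cases; cases y rule: circle_cases)
      (metis dist_circle_of int_dist_minus minus_diff_eq)
  have ev: "eventually P uniformity \<longleftrightarrow> (\<exists>e>0. \<forall>x y. dist x y < e \<longrightarrow> P (x, y))"
    for P :: "circle \<times> circle \<Rightarrow> bool"
    unfolding uni
    by (subst eventually_INF_base)
      (auto simp: eventually_principal Bex_def subset_eq intro: exI[of _ "min _ _"])
  show "open U \<longleftrightarrow> (\<forall>x\<in>U. \<forall>\<^sub>F (x', y) in uniformity. x' = x \<longrightarrow> y \<in> U)"
    for U :: "circle set"
    unfolding open_circle_iff_dist ev by (auto simp: comm)
qed

end

lemma dist_add_right [simp]: "dist (x + z) (y + z) = dist x y" for x y z :: circle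
  by (simp add: dist_circle_def)

lemma dist_add_left [simp]: "dist (z + x) (z + y) = dist x y" for x y z :: circle
  by (simp add: dist_circle_def)

lemma circle_of_surj: "circle_of ` {0..1} = UNIV"
proof -
  have "x \<in> circle_of ` {0..1}" for x
    by (cases x rule: circle_cases) auto
  then show ?thesis by blast
qed

lemma compact_UNIV_circle: "compact (UNIV :: circle set)"
  using compact_continuous_image[OF continuous_on_circle_of compact_Icc]
  by (metis circle_of_surj)

lemma compact_UNIV_torus: "compact (UNIV :: torus set)"
  using compact_Times[OF compact_UNIV_circle compact_UNIV_circle] by simp

instance circle :: second_countable_topology
proof
  define B :: "circle set set" where "B = (\<lambda>(q, n). ball (circle_of (of_rat q)) (1 / real (Suc n))) ` UNIV"
  have "countable B" unfolding B_def by simp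
  moreover have "topological_basis B"
  proof (rule topological_basisI)
    show "open b" if "b \<in> B" for b using that unfolding B_def by auto
    fix U :: "circle set" and x assume U: "open U" "x \<in> U"
    then obtain e where e: "e > 0" "ball x e \<subseteq> U" by (meson open_contains_ball)
    obtain n where n: "1 / real (Suc n) < e / 2"
      using reals_Archimedean[of "e / 2"] e(1) by (auto simp: inverse_eq_divide)
    obtain s where s: "x = circle_of s" by (metis circle_cases)
    obtain q where q: "s < of_rat q" "of_rat q < s + 1 / real (Suc n)"
      using of_rat_dense[of s "s + 1 / real (Suc n)"] by auto
    have d: "dist (circle_of (of_rat q)) x < 1 / real (Suc n)"
      using dist_circle_of_le[of "of_rat q" s] q s by simp
    let ?b = "ball (circle_of (of_rat q)) (1 / real (Suc n))"
    have "?b \<subseteq> ball x e"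
    proof
      fix y assume "y \<in> ?b"
      then show "y \<in> ball x e"
        using d n dist_triangle3[of x y "circle_of (of_rat q)"] by simp
    qed
    moreover have "?b \<in> B" unfolding B_def by auto
    ultimately show "\<exists>b\<in>B. x \<in> b \<and> b \<subseteq> U" using d e(2) by (intro bexI[of _ ?b]) auto
  qed
  ultimately show "\<exists>B :: circle set set. countable B \<and> open = generate_topology B"
    using topological_basis_imp_subbasis by blast
qed

lemma continuous_on_add_circle [continuous_intros]:
  fixes f g :: "'a :: topological_space \<Rightarrow> circle"
  assumes "continuous_on A f" "continuous_on A g"
  shows "continuous_on A (\<lambda>x. f x + g x)"
proof -
  have "continuous_on UNIV (\<lambda>z :: circle \<times> circle. fst z + snd z)"
    unfolding continuous_on_iff
  proof (intro ballI allI impI)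
    fix z :: "circle \<times> circle" and e :: real assume "e > 0"
    have "dist (fst w + snd w) (fst z + snd z) < e" if "dist w z < e / 2" for w
    proof -
      have "dist (fst w + snd w) (fst z + snd z) \<le> dist (fst w + snd w) (fst z + snd w) + dist (fst z + snd w) (fst z + snd z)"
        by (rule dist_triangle)
      also have "\<dots> \<le> dist w z + dist w z"
        using dist_fst_le[of w z] dist_snd_le[of w z] by simp
      finally show ?thesis using that by simp
    qed
    then show "\<exists>d>0. \<forall>w\<in>UNIV. dist w z < d \<longrightarrow> dist (fst w + snd w) (fst z + snd z) < e"
      using \<open>e > 0\<close> by (intro exI[of _ "e / 2"]) auto
  qed
  from continuous_on_compose2[OF this continuous_on_Pair[OF assms]] show ?thesis by simp
qed

lift_definition circle_mult :: "nat \<Rightarrow> circle \<Rightarrow> circle" is "\<lambda>n x. real n * x"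
  by (metis Ints_mult Ints_of_nat right_diff_distrib)

lemma circle_mult_of: "circle_mult n (circle_of x) = circle_of (real n * x)"
  by (rule circle_mult.abs_eq)

lemma circle_mult_add: "circle_mult n (x + y) = circle_mult n x + circle_mult n y"
  by transfer (simp add: algebra_simps)

lemma circle_mult_minus: "circle_mult n (- x) = - circle_mult n x"
  by transfer simp

lemma circle_mult_add_left: "circle_mult (m + n) x = circle_mult m x + circle_mult n x"
  by transfer (simp add: algebra_simps)

lemma circle_mult_0 [simp]: "circle_mult 0 x = 0"
  by transfer simp

lemma circle_mult_Suc: "circle_mult (Suc n) x = x + circle_mult n x"
  by transfer (simp add: algebra_simps)

lemma circle_mult_mult: "circle_mult m (circle_mult n x) = circle_mult n (circle_mult m x)"
  by transfer (simp add: algebra_simps)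

lemma dist_circle_mult: "dist (circle_mult n x) (circle_mult n y) \<le> real n * dist x y"
proof -
  obtain s where s: "x = circle_of s" by (metis circle_cases)
  obtain t where t: "y = circle_of t" "dist x y = \<bar>s - t\<bar>"
    using dist_circle_representative[of y s] s by metis
  have "dist (circle_mult n x) (circle_mult n y) \<le> \<bar>real n * s - real n * t\<bar>"
    unfolding s t(1) circle_mult_of by (rule dist_circle_of_le)
  also have "\<dots> = real n * dist x y"
    by (simp add: t(2) abs_mult flip: right_diff_distrib)
  finally show ?thesis .
qed

lemma continuous_on_circle_mult [continuous_intros]:
  assumes "continuous_on A f"
  shows "continuous_on A (\<lambda>x. circle_mult n (f x))"
proof -
  have "(real n)-lipschitz_on UNIV (circle_mult n)"
    by (rule lipschitz_onI) (auto simp: dist_circle_mult)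
  then have "continuous_on UNIV (circle_mult n)"
    by (rule lipschitz_on_continuous_on)
  from continuous_on_compose2[OF this assms] show ?thesis by simp
qed

lemma continuous_on_minus_circle [continuous_intros]:
  fixes f :: "'a :: topological_space \<Rightarrow> circle"
  assumes "continuous_on A f"
  shows "continuous_on A (\<lambda>x. - f x)"
proof -
  have "dist (- x) (- y) = dist x y" for x y :: circle
    by (cases x rule: circle_cases; cases y rule: circle_cases)
      (metis (no_types) circle_of_minus dist_circle_of int_dist_minus minus_diff_minus)
  then have "1-lipschitz_on UNIV (uminus :: circle \<Rightarrow> circle)"
    by (intro lipschitz_onI) auto
  then have "continuous_on UNIV (uminus :: circle \<Rightarrow> circle)"
    by (rule lipschitz_on_continuous_on)
  from continuous_on_compose2[OF this assms] show ?thesis by simp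
qed

lemma continuous_on_diff_circle [continuous_intros]:
  fixes f g :: "'a :: topological_space \<Rightarrow> circle"
  assumes "continuous_on A f" "continuous_on A g"
  shows "continuous_on A (\<lambda>x. f x - g x)"
  using continuous_on_add_circle[OF assms(1) continuous_on_minus_circle[OF assms(2)]] by simp

text \<open>Multiplication by \<open>n\<close> already maps every arc of length \<open>1 / n\<close> onto the circle. This makes
  the graph of \<open>x \<mapsto> A(c + q x)\<close> meet every small square once \<open>q\<close> is large.\<close>

lemma circle_mult_eqI:
  assumes "0 < n"
  obtains y where "circle_mult n y = t" "dist y x \<le> 1 / real n"
proof -
  obtain s where s: "x = circle_of s" by (metis circle_cases)
  obtain u where u: "t - circle_mult n x = circle_of u" "0 \<le> u" "u < 1" by (metis circle_cases)
  let ?y = "circle_of (s + u / real n)"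
  have "circle_mult n ?y = circle_mult n x + circle_of u"
    using assms by (simp add: s circle_mult_of distrib_left circle_of_add[symmetric])
  also have "\<dots> = t" by (simp flip: u(1))
  finally have "circle_mult n ?y = t" .
  moreover have "dist ?y x \<le> 1 / real n"
    using dist_circle_of_le[of "s + u / real n" s] u(2,3) assms
    by (simp add: s divide_simps split: if_splits)
  ultimately show ?thesis by (rule that)
qed

lemma irrational_orbit_dense:
  assumes "\<alpha> \<notin> \<rat>" "0 < e"
  shows "\<exists>k. dist (circle_mult k (circle_of \<alpha>)) x < e"
proof -
  obtain s where s: "x = circle_of s" by (metis circle_cases)
  obtain h k where hk: "k > 0" "\<bar>of_int k * \<alpha> - of_int h - s\<bar> < e"
    using sequence_of_fractional_parts_is_dense[OF assms] by metis
  have "dist (circle_mult (nat k) (circle_of \<alpha>)) x = int_dist (of_int k * \<alpha> - s)"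
    using hk(1) by (simp add: s circle_mult_of dist_circle_of)
  also have "\<dots> \<le> \<bar>of_int k * \<alpha> - of_int h - s\<bar>"
    using int_dist_le[of "of_int k * \<alpha> - s" h] by (simp add: algebra_simps)
  finally show ?thesis using hk(2) by (intro exI[of _ "nat k"]) simp
qed

lemma irrational_orbit_uniformly_dense:
  assumes "\<alpha> \<notin> \<rat>" "0 < e"
  shows "\<exists>N. \<forall>x. \<exists>k\<le>N. dist (circle_mult k (circle_of \<alpha>)) x < e"
proof -
  have "compact (UNIV :: circle set)" by (rule compact_UNIV_circle)
  moreover have "UNIV \<subseteq> (\<Union>k. ball (circle_mult k (circle_of \<alpha>)) e)"
    using irrational_orbit_dense[OF assms] by (auto simp: mem_ball)
  ultimately obtain K where K: "finite K" "UNIV \<subseteq> (\<Union>k\<in>K. ball (circle_mult k (circle_of \<alpha>)) e)"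
    by (elim compactE_image[of _ UNIV]) auto
  have "\<exists>k\<le>Max K. dist (circle_mult k (circle_of \<alpha>)) x < e" for x
  proof -
    obtain k where "k \<in> K" "x \<in> ball (circle_mult k (circle_of \<alpha>)) e" using K(2) by blast
    then show ?thesis using K(1) by (intro exI[of _ k]) auto
  qed
  then show ?thesis by blast
qed

text \<open>By compactness the multiples of \<open>a\<close> have a Cauchy subsequence, and the difference of two of its
  members is a multiple of \<open>a\<close> close to \<open>0\<close>; far apart members make the factor large.\<close>

lemma rotation_almost_returns:
  fixes a :: circle
  assumes "0 < e"
  obtains q where "Q \<le> q" "0 < q" "dist (circle_mult q a) 0 < e"
proof -
  let ?s = "\<lambda>k. circle_mult k a"
  have "seq_compact (UNIV :: circle set)"
    using compact_UNIV_circle compact_eq_seq_compact_metric by blast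
  then obtain l r where r: "strict_mono r" "(?s \<circ> r) \<longlonglongrightarrow> l"
    unfolding seq_compact_def by (metis UNIV_I)
  then have "Cauchy (?s \<circ> r)" by (simp add: LIMSEQ_imp_Cauchy)
  then obtain N where N: "\<And>m n. m \<ge> N \<Longrightarrow> n \<ge> N \<Longrightarrow> dist (?s (r m)) (?s (r n)) < e"
    using assms unfolding Cauchy_def comp_def by blast
  let ?m = "N + Suc Q"
  define q where "q = r ?m - r N"
  have ge: "r N + Suc Q \<le> r ?m"
  proof -
    have "r N + j \<le> r (N + j)" for j
      using r(1) by (induction j) (auto simp: strict_mono_Suc_iff intro: Suc_leI le_less_trans)
    then show ?thesis .
  qed
  have "?s (r ?m) = ?s q + ?s (r N)"
    using ge by (simp add: q_def flip: circle_mult_add_left)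
  then have "dist (?s q) 0 = dist (?s (r ?m)) (?s (r N))"
    by (simp add: dist_circle_def)
  then show ?thesis
    using N[of ?m N] ge by (intro that[of q]) (auto simp: q_def)
qed

section \<open>Lebesgue measure and unique ergodicity of irrational rotations\<close>

lemma measurable_circle_shift [measurable]: "(\<lambda>x :: circle. x + t) \<in> borel_measurable borel"
  by (intro borel_measurable_continuous_onI continuous_intros)

lemma measurable_circle_add [measurable]:
  assumes "f \<in> borel_measurable M" "g \<in> borel_measurable M"
  shows "(\<lambda>x. f x + g x :: circle) \<in> borel_measurable M"
proof -
  have "(\<lambda>z :: torus. fst z + snd z) \<in> borel_measurable borel"
    by (intro borel_measurable_continuous_onI continuous_intros)
  from measurable_compose[OF borel_measurable_Pair[OF assms] this] show ?thesis by simp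
qed

lemma sets_circle_leb [simp]: "sets circle_leb = sets borel"
  and space_circle_leb [simp]: "space circle_leb = UNIV"
  by (simp_all add: circle_leb_def)

lemma measurable_circle_leb [simp]: "measurable circle_leb N = measurable borel N"
  by (rule measurable_cong_sets) simp_all

lemma prob_space_circle_leb: "prob_space circle_leb"
proof -
  have "prob_space (restrict_space lborel {0..<1 :: real})"
    by (rule prob_spaceI) (simp add: space_restrict_space emeasure_restrict_space)
  then show ?thesis
    unfolding circle_leb_def by (rule prob_space.prob_space_distr) (rule measurable_circle_of)
qed

lemma emeasure_circle_leb:
  assumes "B \<in> sets borel"
  shows "emeasure circle_leb B = emeasure lborel (circle_of -` B \<inter> {0..<1})"
proof -
  have "emeasure circle_leb B = emeasure (restrict_space lborel {0..<1}) (circle_of -` B \<inter> {0..<1})"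
    unfolding circle_leb_def
    by (subst emeasure_distr) (use assms measurable_circle_of in \<open>auto simp: space_restrict_space\<close>)
  then show ?thesis by (simp add: emeasure_restrict_space)
qed

lemma measurable_circle_of_borel [measurable]: "circle_of \<in> borel_measurable borel"
  by (intro borel_measurable_continuous_onI continuous_on_circle_of)

lemma emeasure_lborel_shift:
  assumes [measurable]: "A \<in> sets borel"
  shows "emeasure lborel {x. x + c \<in> A} = emeasure lborel (A :: real set)"
proof -
  have "emeasure lborel A = emeasure (distr lborel borel ((+) c)) A"
    by (simp add: lborel_distr_plus)
  also have "\<dots> = emeasure lborel {x. x + c \<in> A}"
    by (subst emeasure_distr) (auto simp: vimage_def add.commute)
  finally show ?thesis by simp
qed

text \<open>Lift to a \<open>1\<close>-periodic set \<open>P\<close> of reals: the windows \<open>[0, 1)\<close> and \<open>[s, s + 1)\<close> differ by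
  moving the piece \<open>[0, s)\<close> of the first one by a unit, so \<open>P\<close> has the same measure in both.\<close>

lemma circle_leb_shift:
  assumes [measurable]: "B \<in> sets borel"
  shows "emeasure circle_leb {x. x + t \<in> B} = emeasure circle_leb B"
proof -
  obtain s where s: "t = circle_of s" "0 \<le> s" "s < 1" by (metis circle_cases)
  define P where "P = circle_of -` B"
  have P [measurable]: "P \<in> sets borel" unfolding P_def using measurable_sets[OF measurable_circle_of_borel assms] by simp
  have per: "x + of_int n \<in> P \<longleftrightarrow> x \<in> P" for x n
  proof -
    have "circle_of (x + of_int n) = circle_of x" by (simp add: circle.abs_eq_iff)
    then show ?thesis by (simp add: P_def)
  qed
  have meas: "{x. x + t \<in> B} \<in> sets borel"
    using measurable_sets[OF measurable_circle_shift assms, of t] by (simp add: vimage_def)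
  have "emeasure circle_leb {x. x + t \<in> B} = emeasure lborel ({x. x + s \<in> P} \<inter> {0..<1})"
    by (subst emeasure_circle_leb[OF meas]) (simp add: s P_def circle_of_add vimage_def)
  also have "{x. x + s \<in> P} \<inter> {0..<1} = {x. x + s \<in> P \<inter> {s..<s + 1}}" by auto
  also have "emeasure lborel \<dots> = emeasure lborel (P \<inter> {s..<s + 1})"
    by (rule emeasure_lborel_shift) simp
  also have "P \<inter> {s..<s + 1} = (P \<inter> {s..<1}) \<union> (P \<inter> {1..<s + 1})" using s by auto
  also have "emeasure lborel \<dots> = emeasure lborel (P \<inter> {s..<1}) + emeasure lborel (P \<inter> {1..<s + 1})"
    by (rule plus_emeasure[symmetric]) auto
  also have "emeasure lborel (P \<inter> {1..<s + 1}) = emeasure lborel {x. x + 1 \<in> P \<inter> {1..<s + 1}}"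
    by (rule emeasure_lborel_shift[symmetric]) simp
  also have "{x. x + 1 \<in> P \<inter> {1..<s + 1}} = P \<inter> {0..<s}" using per[of _ 1] by auto
  also have "emeasure lborel (P \<inter> {s..<1}) + emeasure lborel (P \<inter> {0..<s})
      = emeasure lborel ((P \<inter> {s..<1}) \<union> (P \<inter> {0..<s}))"
    by (rule plus_emeasure) auto
  also have "(P \<inter> {s..<1}) \<union> (P \<inter> {0..<s}) = P \<inter> {0..<1}" using s by auto
  also have "emeasure lborel \<dots> = emeasure circle_leb B"
    by (simp add: emeasure_circle_leb P_def)
  finally show ?thesis .
qed

lemma AE_circle_leb_shift:
  assumes "AE x in circle_leb. x \<in> B" "B \<in> sets borel"
  shows "AE x in circle_leb. x + t \<in> B"
proof -
  interpret prob_space circle_leb by (rule prob_space_circle_leb)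
  have "emeasure circle_leb B = 1"
    using assms emeasure_eq_1_AE by simp
  then have "emeasure circle_leb {x. x + t \<in> B} = 1" using assms(2) by (simp add: circle_leb_shift)
  moreover have "{x. x + t \<in> B} \<in> sets borel"
    using measurable_sets[OF measurable_circle_shift assms(2), of t] by (simp add: vimage_def)
  ultimately have "AE x in circle_leb. x \<in> {x. x + t \<in> B}"
    by (intro AE_prob_1) (simp add: emeasure_eq_measure)
  then show ?thesis by simp
qed

lemma distr_circle_leb_rotation: "distr circle_leb circle_leb (rotation \<alpha>) = circle_leb"
proof (rule measure_eqI)
  fix B assume "B \<in> sets (distr circle_leb circle_leb (rotation \<alpha>))"
  then have B: "B \<in> sets borel" by simp
  have "rotation \<alpha> \<in> measurable circle_leb circle_leb"
    by (simp add: rotation_eq[abs_def] measurable_circle_shift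
        cong: measurable_cong_sets)
  then show "emeasure (distr circle_leb circle_leb (rotation \<alpha>)) B = emeasure circle_leb B"
    using B circle_leb_shift[OF B, of "circle_of \<alpha>"]
    by (simp add: emeasure_distr rotation_eq vimage_def)
qed simp

text \<open>The measure is invariant under translation by all multiples of \<open>\<alpha>\<close>, and these approximate
  \<open>t\<close>. Measures of translates of an open set are lower semicontinuous in the translation (Fatou's
  lemma), so the inequality survives in the limit.\<close>

lemma open_measure_shift_le:
  fixes m :: "circle measure"
  assumes m: "prob_space m" "sets m = sets borel"
    and inv: "\<And>B. B \<in> sets borel \<Longrightarrow> emeasure m {x. x + circle_of \<alpha> \<in> B} = emeasure m B"
    and \<alpha>: "\<alpha> \<notin> \<rat>" and U: "open U"
  shows "emeasure m {x. x + t \<in> U} \<le> emeasure m U"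
proof -
  interpret prob_space m by (rule m)
  have [measurable_cong]: "sets m = sets borel" by (rule m)
  have shift_sets: "{x. x + c \<in> B} \<in> sets borel" if "B \<in> sets borel" for B and c :: circle
    using measurable_sets[OF measurable_circle_shift that, of c] by (simp add: vimage_def)
  have inv_k: "emeasure m {x. x + circle_mult k (circle_of \<alpha>) \<in> B} = emeasure m B" if "B \<in> sets borel" for k B
    using that
  proof (induction k arbitrary: B)
    case (Suc k)
    have "{x. x + circle_mult (Suc k) (circle_of \<alpha>) \<in> B}
        = {x. x + circle_mult k (circle_of \<alpha>) \<in> {x. x + circle_of \<alpha> \<in> B}}"
      by (simp add: circle_mult_Suc add_ac)
    then show ?case
      using Suc.IH[OF shift_sets[OF Suc.prems]] inv[OF Suc.prems] by simp
  qed simp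
  have "\<exists>k. dist (circle_mult k (circle_of \<alpha>)) t < 1 / real (Suc n)" for n
    by (rule irrational_orbit_dense[OF \<alpha>]) simp
  then obtain k where k: "\<And>n. dist (circle_mult (k n) (circle_of \<alpha>)) t < 1 / real (Suc n)" by metis
  define s where "s n = circle_mult (k n) (circle_of \<alpha>)" for n
  have lim: "s \<longlonglongrightarrow> t"
  proof (rule metric_tendsto_imp_tendsto[OF lim_inverse_n'])
    show "\<forall>\<^sub>F n in sequentially. dist (s n) t \<le> dist (1 / real n) 0"
    proof (rule eventually_sequentiallyI[of 1])
      fix n :: nat assume n: "1 \<le> n"
      have "1 / real (Suc n) \<le> 1 / real n" using n by (simp add: divide_simps)
      with k[of n] show "dist (s n) t \<le> dist (1 / real n) 0" by (simp add: s_def)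
    qed
  qed
  have U': "U \<in> sets borel" using U by simp
  have "emeasure m {x. x + t \<in> U} = (\<integral>\<^sup>+x. indicator {x. x + t \<in> U} x \<partial>m)"
    using shift_sets[OF U'] by (simp add: m)
  also have "\<dots> \<le> (\<integral>\<^sup>+x. liminf (\<lambda>n. indicator {x. x + s n \<in> U} x) \<partial>m)"
  proof (rule nn_integral_mono)
    fix x
    show "indicator {x. x + t \<in> U} x \<le> liminf (\<lambda>n. indicator {x. x + s n \<in> U} x :: ennreal)"
    proof (cases "x + t \<in> U")
      case True
      have "(\<lambda>n. x + s n) \<longlonglongrightarrow> x + t"
        using lim by (simp add: tendsto_iff)
      then have "\<forall>\<^sub>F n in sequentially. x + s n \<in> U"
        using U True by (rule topological_tendstoD)
      then have "1 \<le> liminf (\<lambda>n. indicator {x. x + s n \<in> U} x :: ennreal)"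
        by (intro Liminf_bounded, elim eventually_mono) simp
      then show ?thesis using True by simp
    qed simp
  qed
  also have "\<dots> \<le> liminf (\<lambda>n. \<integral>\<^sup>+x. indicator {x. x + s n \<in> U} x \<partial>m)"
    by (rule nn_integral_liminf) (use shift_sets[OF U'] in \<open>simp add: m\<close>)
  also have "\<dots> = emeasure m U"
    using shift_sets[OF U'] by (simp add: m s_def inv_k[OF U'] Liminf_const)
  finally show ?thesis .
qed

text \<open>An invariant probability is invariant under every translation, at least on open sets, as
  the previous bound can be applied to \<open>t\<close> and \<open>- t\<close>. Averaging the measures of the translates of a set
  over \<open>t\<close> and exchanging the order of integration gives its Lebesgue measure.\<close>

theorem irrational_rotation_uniquely_ergodic:
  fixes m :: "circle measure"
  assumes m: "prob_space m" "sets m = sets borel"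
    and inv: "\<And>B. B \<in> sets borel \<Longrightarrow> emeasure m {x. x + circle_of \<alpha> \<in> B} = emeasure m B"
    and \<alpha>: "\<alpha> \<notin> \<rat>"
  shows "m = circle_leb"
proof -
  interpret m: prob_space m by (rule m)
  interpret L: prob_space circle_leb by (rule prob_space_circle_leb)
  interpret pair_sigma_finite m circle_leb ..
  have [measurable_cong]: "sets m = sets borel" "sets circle_leb = sets borel" by (simp_all add: m)
  have shift_sets: "{x. x + c \<in> B} \<in> sets borel" if "B \<in> sets borel" for B and c :: circle
    using measurable_sets[OF measurable_circle_shift that, of c] by (simp add: vimage_def)
  have eq: "emeasure m U = emeasure circle_leb U" if U: "open U" for U
  proof -
    have shift_eq: "emeasure m {x. x + t \<in> U} = emeasure m U" for t
    proof (rule antisym)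
      show "emeasure m {x. x + t \<in> U} \<le> emeasure m U"
        by (rule open_measure_shift_le[OF m inv \<alpha> U])
      have "open {x. x + t \<in> U}"
        using open_vimage[OF U, of "\<lambda>x. x + t"] by (simp add: vimage_def continuous_intros)
      from open_measure_shift_le[OF m inv \<alpha> this, of "- t"]
      show "emeasure m U \<le> emeasure m {x. x + t \<in> U}" by simp
    qed
    have [measurable]: "U \<in> sets borel" using U by simp
    let ?f = "\<lambda>x t. indicator U (x + t) :: ennreal"
    have "emeasure m U = (\<integral>\<^sup>+t. emeasure m U \<partial>circle_leb)"
      using L.emeasure_space_1 by simp
    also have "\<dots> = (\<integral>\<^sup>+t. \<integral>\<^sup>+x. ?f x t \<partial>m \<partial>circle_leb)"
    proof (rule nn_integral_cong)
      fix t
      have "(\<integral>\<^sup>+x. ?f x t \<partial>m) = (\<integral>\<^sup>+x. indicator {x. x + t \<in> U} x \<partial>m)"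
        by (rule nn_integral_cong) (simp add: indicator_def)
      then show "emeasure m U = (\<integral>\<^sup>+x. ?f x t \<partial>m)"
        using shift_sets[of U t] by (simp add: m shift_eq)
    qed
    also have "\<dots> = (\<integral>\<^sup>+x. \<integral>\<^sup>+t. ?f x t \<partial>circle_leb \<partial>m)"
      by (rule Fubini') measurable
    also have "\<dots> = (\<integral>\<^sup>+x. emeasure circle_leb U \<partial>m)"
    proof (rule nn_integral_cong)
      fix x
      have "(\<integral>\<^sup>+t. ?f x t \<partial>circle_leb) = (\<integral>\<^sup>+t. indicator {t. t + x \<in> U} t \<partial>circle_leb)"
        by (rule nn_integral_cong) (simp add: indicator_def add.commute)
      then show "(\<integral>\<^sup>+t. ?f x t \<partial>circle_leb) = emeasure circle_leb U"
        using shift_sets[of U x] by (simp add: circle_leb_shift)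
    qed
    also have "\<dots> = emeasure circle_leb U" using m.emeasure_space_1 by simp
    finally show ?thesis .
  qed
  show ?thesis
  proof (rule measure_eqI_generator_eq[where E = "{U. open U}" and \<Omega> = UNIV and A = "\<lambda>_. UNIV"])
    show "Int_stable {U :: circle set. open U}" by (auto simp: Int_stable_def)
    show "emeasure m X = emeasure circle_leb X" if "X \<in> {U. open U}" for X
      using eq that by simp
    show "sets m = sigma_sets UNIV {U. open U}" "sets circle_leb = sigma_sets UNIV {U. open U}"
      by (simp_all add: m borel_def)
  qed auto
qed

section \<open>Circle homeomorphisms that contract all but a short arc\<close>

text \<open>A continuous staircase: it climbs from \<open>n\<close> to \<open>n + 1\<close> on \<open>[n, n + c]\<close> and is constant on
  \<open>[n + c, n + 1]\<close>.\<close>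

definition stair :: "real \<Rightarrow> real \<Rightarrow> real" where
  "stair c y = of_int \<lfloor>y\<rfloor> + min 1 (frac y / c)"

text \<open>Adding a small multiple of the identity to the staircase makes it strictly increasing, hence
  the lift of a circle homeomorphism; intervals on which the staircase is constant are mapped
  to intervals of length at most \<open>c\<close>.\<close>

definition pinch_lift :: "real \<Rightarrow> real \<Rightarrow> real" where
  "pinch_lift c y = c * y + (1 - c) * stair c y"

lemma stair_mono:
  assumes "0 < c" "x \<le> y"
  shows "stair c x \<le> stair c y"
proof (cases "\<lfloor>x\<rfloor> = \<lfloor>y\<rfloor>")
  case True
  then have "frac x / c \<le> frac y / c"
    using assms by (intro divide_right_mono) (auto simp: frac_def)
  then show ?thesis using True by (simp add: stair_def min_def)
next
  case False
  then have "\<lfloor>x\<rfloor> + 1 \<le> \<lfloor>y\<rfloor>"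
    using floor_mono[OF assms(2)] by linarith
  then have "real_of_int \<lfloor>x\<rfloor> + 1 \<le> real_of_int \<lfloor>y\<rfloor>" by linarith
  moreover have "0 \<le> min 1 (frac y / c)" using assms(1) by simp
  moreover have "min 1 (frac x / c) \<le> 1" by simp
  ultimately show ?thesis unfolding stair_def by linarith
qed

text \<open>Every part of the staircase has slope at most \<open>1 / c\<close>, and at most one integer separates
  \<open>x\<close> from \<open>y\<close>.\<close>

lemma stair_Lipschitz:
  assumes "0 < c" "c \<le> 1" "x \<le> y" "y < x + 1"
  shows "stair c y - stair c x \<le> (y - x) / c"
proof (cases "\<lfloor>x\<rfloor> = \<lfloor>y\<rfloor>")
  case True
  have "frac y / c = frac x / c + (y - x) / c"
    using True assms(1) by (simp add: frac_def field_simps)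
  moreover have "0 \<le> (y - x) / c" using assms by simp
  ultimately have "min 1 (frac y / c) \<le> min 1 (frac x / c) + (y - x) / c" by linarith
  then show ?thesis using True by (simp add: stair_def)
next
  case False
  then have fl: "\<lfloor>y\<rfloor> = \<lfloor>x\<rfloor> + 1"
    using floor_mono[OF assms(3)] assms(4) by linarith
  have y: "min 1 (frac y / c) \<le> (y - of_int \<lfloor>x\<rfloor> - 1) / c"
    using fl by (simp add: frac_def diff_diff_eq)
  have x: "min 1 (frac x / c) \<ge> 1 + (x - of_int \<lfloor>x\<rfloor> - 1) / c"
  proof -
    have "x - of_int \<lfloor>x\<rfloor> - 1 \<le> 0" by linarith
    then have "(x - of_int \<lfloor>x\<rfloor> - 1) / c \<le> 0" using assms(1) by (simp add: divide_le_0_iff)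
    moreover have "1 + (x - of_int \<lfloor>x\<rfloor> - 1) / c \<le> frac x / c"
      using assms(1,2) by (simp add: frac_def field_simps)
    ultimately show ?thesis by simp
  qed
  have "(y - of_int \<lfloor>x\<rfloor> - 1) / c - (x - of_int \<lfloor>x\<rfloor> - 1) / c = (y - x) / c"
    by (simp flip: diff_divide_distrib)
  moreover have "real_of_int \<lfloor>y\<rfloor> = real_of_int \<lfloor>x\<rfloor> + 1" by (simp add: fl)
  ultimately show ?thesis using x y unfolding stair_def by linarith
qed

lemma continuous_on_pinch_lift:
  assumes "0 < c" "c \<le> 1"
  shows "continuous_on UNIV (pinch_lift c)"
proof -
  have lip: "\<bar>stair c y - stair c x\<bar> \<le> \<bar>y - x\<bar> / c" if "\<bar>y - x\<bar> < 1" for x y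
  proof (cases "x \<le> y")
    case True
    then show ?thesis
      using stair_mono[OF assms(1) True] stair_Lipschitz[OF assms True] that by simp
  next
    case False
    then have "y \<le> x" by simp
    then show ?thesis
      using stair_mono[OF assms(1) \<open>y \<le> x\<close>] stair_Lipschitz[OF assms \<open>y \<le> x\<close>] that by simp
  qed
  have "continuous_on UNIV (stair c)"
    unfolding continuous_on_iff
  proof (intro ballI allI impI)
    fix x e :: real assume "0 < e"
    show "\<exists>d>0. \<forall>y\<in>UNIV. dist y x < d \<longrightarrow> dist (stair c y) (stair c x) < e"
    proof (intro exI[of _ "min 1 (c * e)"] conjI ballI impI)
      show "0 < min 1 (c * e)" using \<open>0 < e\<close> assms by simp
      fix y assume "dist y x < min 1 (c * e)"
      then have "\<bar>y - x\<bar> < 1" "\<bar>y - x\<bar> / c < e"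
        using assms(1) by (auto simp: dist_real_def field_simps)
      with lip[of y x] show "dist (stair c y) (stair c x) < e"
        by (simp add: dist_real_def)
    qed
  qed
  then show ?thesis
    unfolding pinch_lift_def[abs_def] by (intro continuous_intros)
qed

lemma pinch_lift_strict_mono:
  assumes "0 < c" "c \<le> 1" "x < y"
  shows "pinch_lift c x < pinch_lift c y"
proof -
  have "c * x < c * y" using assms by simp
  moreover have "(1 - c) * stair c x \<le> (1 - c) * stair c y"
    using stair_mono[of c x y] assms by (intro mult_left_mono) auto
  ultimately show ?thesis unfolding pinch_lift_def by linarith
qed

lemma pinch_lift_add_of_int: "pinch_lift c (y + of_int n) = pinch_lift c y + of_int n"
  by (simp add: pinch_lift_def stair_def frac_def algebra_simps)

lemma pinch_lift_of_int: "pinch_lift c (of_int n) = of_int n"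
  by (simp add: pinch_lift_def stair_def algebra_simps)

lift_definition pinch :: "real \<Rightarrow> circle \<Rightarrow> circle" is pinch_lift
proof -
  fix c x y :: real assume "x - y \<in> \<int>"
  then obtain n where "x = y + of_int n" by (metis Ints_cases add.commute diff_add_cancel)
  then show "pinch_lift c x - pinch_lift c y \<in> \<int>" by (simp add: pinch_lift_add_of_int)
qed

lemma pinch_of: "pinch c (circle_of x) = circle_of (pinch_lift c x)"
  by (rule pinch.abs_eq)

lemma pinch_homeomorphism:
  assumes c: "0 < c" "c \<le> 1"
  shows "\<exists>g. homeomorphism UNIV UNIV (pinch c) g"
proof (rule homeomorphism_compact[OF compact_UNIV_circle])
  show "continuous_on UNIV (pinch c)"
    unfolding continuous_on_open_vimage[OF open_UNIV]
  proof (intro allI impI)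
    fix U :: "circle set" assume "open U"
    then have "open (pinch_lift c -` circle_of -` U)"
      using open_vimage[OF _ continuous_on_pinch_lift[OF c]] by (simp add: open_circle_def)
    moreover have "circle_of -` pinch c -` U = pinch_lift c -` circle_of -` U"
      by (auto simp: pinch_of)
    ultimately show "open (pinch c -` U \<inter> UNIV)"
      by (simp add: open_circle_def)
  qed
  show "pinch c ` UNIV = UNIV"
  proof -
    have "z \<in> range (pinch c)" for z
    proof -
      obtain v where v: "z = circle_of v" by (metis circle_cases)
      have "\<exists>x\<ge>of_int \<lfloor>v\<rfloor>. x \<le> of_int (\<lfloor>v\<rfloor> + 1) \<and> pinch_lift c x = v"
      proof (rule IVT')
        show "pinch_lift c (of_int \<lfloor>v\<rfloor>) \<le> v" "v \<le> pinch_lift c (of_int (\<lfloor>v\<rfloor> + 1))"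
          unfolding pinch_lift_of_int by linarith+
      qed (use continuous_on_subset[OF continuous_on_pinch_lift[OF c]] in auto)
      then obtain x where "pinch_lift c x = v" by blast
      then have "z = pinch c (circle_of x)" by (simp add: v pinch_of)
      then show ?thesis by simp
    qed
    then show ?thesis by blast
  qed
  show "inj (pinch c)"
  proof (rule injI)
    fix s t assume eq: "pinch c s = pinch c t"
    obtain x where x: "s = circle_of x" by (metis circle_cases)
    obtain y where y: "t = circle_of y" by (metis circle_cases)
    have "pinch_lift c x - pinch_lift c y \<in> \<int>"
      using eq by (simp add: x y pinch_of circle.abs_eq_iff)
    then obtain n where "pinch_lift c x = pinch_lift c y + of_int n"
      by (metis Ints_cases add.commute diff_add_cancel)
    then have "pinch_lift c x = pinch_lift c (y + of_int n)" by (simp add: pinch_lift_add_of_int)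
    then have "x = y + of_int n"
      using pinch_lift_strict_mono[OF c, of x "y + of_int n"] pinch_lift_strict_mono[OF c, of "y + of_int n" x]
      by (metis less_irrefl linorder_less_linear)
    then show "s = t" by (simp add: x y circle.abs_eq_iff)
  qed
qed

text \<open>Away from the \<open>c\<close>-neighbourhood of \<open>0\<close> the staircase is constant with integer value, and
  only the small linear part remains.\<close>

lemma dist_pinch_le:
  assumes c: "0 < c" "c \<le> 1" and t: "c \<le> dist t 0"
  shows "dist (pinch c t) 0 \<le> c"
proof -
  obtain x where x: "t = circle_of x" "0 \<le> x" "x < 1" by (metis circle_cases)
  have "dist t 0 \<le> x"
    using dist_circle_of_le[of x 0] x by (simp add: circle_of_0)
  with t have "c \<le> x" by simp
  have "\<lfloor>x\<rfloor> = 0" using x by linarith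
  then have "stair c x = 1" using \<open>c \<le> x\<close> c(1) by (simp add: stair_def frac_def)
  then have L: "pinch_lift c x = 1 - c * (1 - x)" by (simp add: pinch_lift_def algebra_simps)
  have "dist (pinch c t) 0 = int_dist (pinch_lift c x)"
    using dist_circle_of[of "pinch_lift c x" 0] by (simp add: x pinch_of circle_of_0)
  also have "\<dots> \<le> \<bar>pinch_lift c x - of_int 1\<bar>" by (rule int_dist_le)
  also have "\<dots> = c * (1 - x)" using c x by (simp add: L)
  also have "\<dots> \<le> c * 1" using c x by (intro mult_left_mono) auto
  finally show ?thesis by simp
qed

section \<open>Perturbations and recurrence\<close>

text \<open>Errors propagate through the modulus of continuity of \<open>g\<close>, so \<open>d\<close> is uniform in \<open>f\<close>: a
  property of finitely many iterates of \<open>g\<close> with some room to spare is inherited by every map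
  close to \<open>g\<close>.\<close>

lemma iterates_close:
  fixes g :: "'a :: metric_space \<Rightarrow> 'a"
  assumes "compact (UNIV :: 'a set)" "continuous_on UNIV g" "0 < r"
  shows "\<exists>d>0. \<forall>f. (\<forall>z. dist (f z) (g z) \<le> d) \<longrightarrow> (\<forall>k\<le>N. \<forall>z. dist ((f ^^ k) z) ((g ^^ k) z) < r)"
  using assms(3)
proof (induction N arbitrary: r)
  case 0
  then show ?case by (intro exI[of _ 1]) auto
next
  case (Suc N)
  have "uniformly_continuous_on UNIV g"
    using assms by (intro compact_uniformly_continuous)
  then obtain s where s: "0 < s" "\<And>u v. dist u v < s \<Longrightarrow> dist (g u) (g v) < r / 2"
    using Suc.prems unfolding uniformly_continuous_on_def by (metis UNIV_I half_gt_zero)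
  obtain d where d: "0 < d"
    "\<And>f k z. (\<And>z. dist (f z) (g z) \<le> d) \<Longrightarrow> k \<le> N \<Longrightarrow> dist ((f ^^ k) z) ((g ^^ k) z) < min r s"
    using Suc.IH[of "min r s"] Suc.prems s(1) unfolding min_less_iff_conj by metis
  show ?case
  proof (intro exI[of _ "min d (r / 2)"] conjI allI impI)
    show "0 < min d (r / 2)" using d(1) Suc.prems by simp
    fix f k z assume f: "\<forall>z. dist (f z) (g z) \<le> min d (r / 2)" and k: "k \<le> Suc N"
    have close: "dist ((f ^^ j) z) ((g ^^ j) z) < min r s" if "j \<le> N" for j
      using d(2)[of f j z] f that by simp
    show "dist ((f ^^ k) z) ((g ^^ k) z) < r"
    proof (cases k)
      case 0
      then show ?thesis using Suc.prems by simp
    next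
      case (Suc j)
      then have "j \<le> N" using k by simp
      have "dist (f ((f ^^ j) z)) (g ((g ^^ j) z))
          \<le> dist (f ((f ^^ j) z)) (g ((f ^^ j) z)) + dist (g ((f ^^ j) z)) (g ((g ^^ j) z))"
        by (rule dist_triangle)
      also have "\<dots> < r / 2 + r / 2"
        using f s(2)[of "(f ^^ j) z" "(g ^^ j) z"] close[OF \<open>j \<le> N\<close>] by (intro add_le_less_mono) auto
      finally show ?thesis by (simp add: Suc)
    qed
  qed
qed

text \<open>The preimages of \<open>B\<close> under the iterates in \<open>J\<close> are disjoint and all have the measure of
  \<open>B\<close>.\<close>

lemma measure_visited_at_disjoint_times:
  fixes f :: "'a :: topological_space \<Rightarrow> 'a"
  assumes inv: "invariant_prob f \<mu>" and B: "B \<in> sets borel"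
    and J: "finite J" "J \<noteq> {}"
    and disj: "\<And>i j z. i \<in> J \<Longrightarrow> j \<in> J \<Longrightarrow> (f ^^ i) z \<in> B \<Longrightarrow> (f ^^ j) z \<in> B \<Longrightarrow> i = j"
  shows "measure \<mu> B \<le> 1 / real (card J)"
proof -
  from inv have \<mu>: "prob_space \<mu>" "sets \<mu> = sets borel" "f \<in> measurable \<mu> \<mu>" "distr \<mu> \<mu> f = \<mu>"
    by (auto simp: invariant_prob_def)
  interpret prob_space \<mu> by fact
  have sp: "space \<mu> = UNIV" using sets_eq_imp_space_eq[OF \<mu>(2)] by simp
  have meas: "(f ^^ j) -` B \<in> sets \<mu> \<and> measure \<mu> ((f ^^ j) -` B) = measure \<mu> B" for j
  proof (induction j)
    case (Suc j)
    have eq: "(f ^^ Suc j) -` B = f -` ((f ^^ j) -` B) \<inter> space \<mu>"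
      by (auto simp: sp funpow_swap1)
    have "measure \<mu> (f -` ((f ^^ j) -` B) \<inter> space \<mu>) = measure (distr \<mu> \<mu> f) ((f ^^ j) -` B)"
      using Suc \<mu>(3) by (simp add: measure_distr)
    then show ?case
      unfolding eq using Suc measurable_sets[OF \<mu>(3)] by (simp add: \<mu>(4))
  qed (simp add: B \<mu>(2))
  have "real (card J) * measure \<mu> B = (\<Sum>j\<in>J. measure \<mu> ((f ^^ j) -` B))"
    by (simp add: meas)
  also have "\<dots> = measure \<mu> (\<Union>j\<in>J. (f ^^ j) -` B)"
    using J meas disj
    by (intro finite_measure_finite_Union[symmetric]) (auto simp: disjoint_family_on_def)
  also have "\<dots> \<le> 1" by (rule prob_le_1)
  finally show ?thesis
    using J by (simp add: field_simps card_gt_0_iff)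
qed

text \<open>By density, choose for each \<open>i < M\<close> a multiple of \<open>\<beta>\<close> close to \<open>i / M\<close>.\<close>

lemma separated_times:
  assumes \<beta>: "\<beta> \<notin> \<rat>" and M: "0 < M"
  obtains J where "finite J" "card J = M"
    "\<And>i j. i \<in> J \<Longrightarrow> j \<in> J \<Longrightarrow> i \<noteq> j \<Longrightarrow>
       1 / (2 * real M) \<le> dist (circle_mult i (circle_of \<beta>)) (circle_mult j (circle_of \<beta>))"
proof -
  have "\<exists>k. dist (circle_mult k (circle_of \<beta>)) (circle_of (real i / real M)) < 1 / (4 * real M)" for i
    by (rule irrational_orbit_dense[OF \<beta>]) (use M in simp)
  then obtain k where k: "\<And>i. dist (circle_mult (k i) (circle_of \<beta>)) (circle_of (real i / real M)) < 1 / (4 * real M)"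
    by metis
  have sep: "1 / (2 * real M) \<le> dist (circle_mult (k i) (circle_of \<beta>)) (circle_mult (k j) (circle_of \<beta>))"
    if ij: "i < M" "j < M" "i \<noteq> j" for i j
  proof -
    define n where "n = round ((real i - real j) / real M)"
    have "int i - int j - n * int M \<noteq> 0"
    proof
      assume "int i - int j - n * int M = 0"
      then have "int M dvd int i - int j" by simp
      then have "int i mod int M = int j mod int M" by (simp add: mod_eq_dvd_iff)
      then show False using ij by simp
    qed
    then have "1 \<le> \<bar>int i - int j - n * int M\<bar>" by linarith
    then have "real_of_int 1 \<le> real_of_int \<bar>int i - int j - n * int M\<bar>"
      by (simp only: of_int_le_iff)
    then have "1 \<le> \<bar>real i - real j - of_int n * real M\<bar>" by simp
    then have "1 / real M \<le> \<bar>real i - real j - of_int n * real M\<bar> / real M"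
      by (intro divide_right_mono) auto
    also have "\<dots> = \<bar>(real i - real j) / real M - of_int n\<bar>"
    proof -
      have "(real i - real j) / real M - of_int n = (real i - real j - of_int n * real M) / real M"
        using M by (simp add: diff_divide_distrib)
      then show ?thesis by simp
    qed
    also have "\<dots> = dist (circle_of (real i / real M)) (circle_of (real j / real M))"
      by (simp add: dist_circle_of int_dist_def n_def diff_divide_distrib)
    also have "\<dots> \<le> dist (circle_mult (k i) (circle_of \<beta>)) (circle_of (real i / real M))
        + dist (circle_mult (k i) (circle_of \<beta>)) (circle_mult (k j) (circle_of \<beta>))
        + dist (circle_mult (k j) (circle_of \<beta>)) (circle_of (real j / real M))"
      by metric
    \<comment> \<open>The two approximation errors \<open>1 / (4 M)\<close> leave half of the gap \<open>1 / M\<close>.\<close>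
    finally show ?thesis using k[of i] k[of j] by (simp add: field_simps)
  qed
  have pos: "0 < 1 / (2 * real M)" using M by simp
  have inj: "inj_on k {..<M}"
  proof (rule inj_onI)
    fix i j assume "i \<in> {..<M}" "j \<in> {..<M}" "k i = k j"
    then show "i = j" using sep[of i j] pos by auto
  qed
  show ?thesis
  proof (rule that[of "k ` {..<M}"])
    show "card (k ` {..<M}) = M" using inj by (simp add: card_image)
  qed (use sep in auto)
qed

section \<open>Conjugating by a twist\<close>

definition fibred_homeo :: "(torus \<Rightarrow> torus) \<Rightarrow> (torus \<Rightarrow> torus) \<Rightarrow> bool" where
  "fibred_homeo G G' \<longleftrightarrow> homeomorphism UNIV UNIV G G' \<and> (\<forall>z. fst (G z) = fst z)"

definition base_shift :: "circle \<Rightarrow> torus \<Rightarrow> torus" where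
  "base_shift a z = (fst z + a, snd z)"

definition conj_shift :: "circle \<Rightarrow> (torus \<Rightarrow> torus) \<Rightarrow> (torus \<Rightarrow> torus) \<Rightarrow> torus \<Rightarrow> torus" where
  "conj_shift a G G' = G \<circ> base_shift a \<circ> G'"

lemma fibred_homeoD:
  assumes "fibred_homeo G G'"
  shows "continuous_on A G" "continuous_on A G'" "G' (G z) = z" "G (G' z) = z"
    "fst (G z) = fst z" "fst (G' z) = fst z"
proof -
  have h: "homeomorphism UNIV UNIV G G'" and f: "\<And>z. fst (G z) = fst z"
    using assms by (auto simp: fibred_homeo_def)
  show "continuous_on A G" "continuous_on A G'"
    using h by (auto simp: homeomorphism_def intro: continuous_on_subset)
  show GG': "G' (G z) = z" "G (G' z) = z" for z
    using h unfolding homeomorphism_def by blast+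
  show "fst (G z) = fst z" by (rule f)
  show "fst (G' z) = fst z" using f[of "G' z"] GG'(2)[of z] by simp
qed

lemma fibred_homeoI:
  assumes "continuous_on UNIV G" "continuous_on UNIV G'" "\<And>z. G' (G z) = z" "\<And>z. G (G' z) = z"
    "\<And>z. fst (G z) = fst z"
  shows "fibred_homeo G G'"
  unfolding fibred_homeo_def using assms by (auto intro!: homeomorphismI)

lemma fibred_homeo_id: "fibred_homeo id id"
  by (rule fibred_homeoI) auto

lemma fibred_homeo_comp:
  assumes "fibred_homeo G G'" "fibred_homeo K K'"
  shows "fibred_homeo (G \<circ> K) (K' \<circ> G')"
proof (rule fibred_homeoI)
  show "continuous_on UNIV (G \<circ> K)" "continuous_on UNIV (K' \<circ> G')"
    by (intro continuous_on_compose fibred_homeoD[OF assms(1)] fibred_homeoD[OF assms(2)])+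
qed (simp_all add: fibred_homeoD[OF assms(1)] fibred_homeoD[OF assms(2)])

lemma continuous_on_base_shift: "continuous_on A (base_shift a)"
  unfolding base_shift_def[abs_def] by (intro continuous_intros)

lemma continuous_on_conj_shift:
  assumes "fibred_homeo G G'"
  shows "continuous_on A (conj_shift a G G')"
  unfolding conj_shift_def
  by (intro continuous_on_compose fibred_homeoD[OF assms] continuous_on_base_shift)

lemma conj_shift_G: "fibred_homeo G G' \<Longrightarrow> conj_shift a G G' (G (x, y)) = G (x + a, y)"
  by (simp add: conj_shift_def base_shift_def fibred_homeoD)

lemma conj_shift_inverse: "fibred_homeo G G' \<Longrightarrow> conj_shift (- a) G G' (conj_shift a G G' z) = z"
proof -
  assume G: "fibred_homeo G G'"
  have "(fst z, snd (G' z)) = G' z" by (rule prod_eqI) (simp_all add: fibred_homeoD[OF G])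
  then show ?thesis by (simp add: conj_shift_def base_shift_def fibred_homeoD[OF G])
qed

lemma fst_conj_shift: "fibred_homeo G G' \<Longrightarrow> fst (conj_shift a G G' z) = fst z + a"
  by (simp add: conj_shift_def base_shift_def fibred_homeoD)

text \<open>The images under \<open>G\<close> of the horizontal circles are invariant curves, on which the conjugate
  acts as the rotation.\<close>

lemma conj_shift_funpow:
  assumes "fibred_homeo G G'"
  shows "(conj_shift a G G' ^^ k) (G (x, y)) = G (x + circle_mult k a, y)"
  by (induction k) (simp_all add: conj_shift_G[OF assms] circle_mult_Suc add_ac)

lemma torus_uniformly_continuous:
  fixes G :: "torus \<Rightarrow> 'b :: metric_space"
  assumes "continuous_on UNIV G" "0 < e"
  obtains d where "0 < d" "\<And>z w. dist z w < d \<Longrightarrow> dist (G z) (G w) < e"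
  using compact_uniformly_continuous[OF assms(1) compact_UNIV_torus] assms(2)
  unfolding uniformly_continuous_on_def by (metis UNIV_I)

lemma circle_uniformly_continuous:
  fixes A :: "circle \<Rightarrow> 'b :: metric_space"
  assumes "continuous_on UNIV A" "0 < e"
  obtains d where "0 < d" "\<And>z w. dist z w < d \<Longrightarrow> dist (A z) (A w) < e"
  using compact_uniformly_continuous[OF assms(1) compact_UNIV_circle] assms(2)
  unfolding uniformly_continuous_on_def by (metis UNIV_I)

lemma dist_torus_le: "dist (x, y) (x', y') \<le> dist x x' + dist y y'" for x x' y y' :: circle
  unfolding dist_Pair_Pair by (rule sqrt_sum_squares_le_sum) auto

lemma dist_torus_same_fibre [simp]: "dist (x, y) (x, y') = dist y y'" for x y y' :: circle
  by (simp add: dist_Pair_Pair)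

text \<open>Approximate forms of the two properties wanted for the limit: minimality, and concentration of
  all invariant measures on a graph, \<open>U\<close> being a neighbourhood of an approximate graph.\<close>

definition almost_minimal :: "real \<Rightarrow> (torus \<Rightarrow> torus) \<Rightarrow> bool" where
  "almost_minimal e f \<longleftrightarrow> (\<forall>z w. \<exists>k. dist ((f ^^ k) z) w < e)"

definition almost_carries :: "real \<Rightarrow> torus set \<Rightarrow> (torus \<Rightarrow> torus) \<Rightarrow> bool" where
  "almost_carries e U f \<longleftrightarrow> (\<forall>\<mu>. invariant_prob f \<mu> \<longrightarrow> measure \<mu> (- U) \<le> e)"

definition twist :: "(circle \<Rightarrow> circle) \<Rightarrow> nat \<Rightarrow> torus \<Rightarrow> torus" where
  "twist A q z = (fst z, A (snd z + circle_mult q (fst z)))"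

definition untwist :: "(circle \<Rightarrow> circle) \<Rightarrow> nat \<Rightarrow> torus \<Rightarrow> torus" where
  "untwist A' q z = (fst z, A' (snd z) - circle_mult q (fst z))"

lemma fibred_homeo_twist:
  assumes "homeomorphism UNIV UNIV A A'"
  shows "fibred_homeo (twist A q) (untwist A' q)"
proof (rule fibred_homeoI)
  have A: "continuous_on UNIV A" "continuous_on UNIV A'" "\<And>x. A' (A x) = x" "\<And>x. A (A' x) = x"
    using assms by (auto simp: homeomorphism_def)
  show "continuous_on UNIV (twist A q)"
    unfolding twist_def[abs_def]
    by (intro continuous_intros continuous_on_compose2[OF A(1)]) auto
  show "continuous_on UNIV (untwist A' q)"
    unfolding untwist_def[abs_def]
    by (intro continuous_intros continuous_on_compose2[OF A(2)]) auto
qed (use assms in \<open>auto simp: twist_def untwist_def homeomorphism_def\<close>)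

text \<open>Conjugation by the twist turns \<open>R\<close> into \<open>(x, y) \<mapsto> (x + a, A(A'(y) + q a))\<close>: the shear
  contributes the constant \<open>q a\<close> only, whatever its slope \<open>q\<close>.\<close>

lemma conj_shift_twist_close:
  assumes A: "homeomorphism UNIV UNIV A A'"
    and mod: "\<And>u v. dist u v < d \<Longrightarrow> dist (A u) (A v) < e"
    and q: "dist (circle_mult q a) 0 < d"
  shows "dist (conj_shift a (twist A q) (untwist A' q) z) (base_shift a z) < e"
proof -
  have AA': "A (A' x) = x" for x using A by (auto simp: homeomorphism_def)
  have "dist (A' (snd z) + circle_mult q a) (A' (snd z) + 0) < d"
    using q by (simp only: dist_add_left)
  from mod[OF this] show ?thesis
    by (simp add: conj_shift_def base_shift_def twist_def untwist_def circle_mult_add AA')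
qed

text \<open>The order of the choices matters. The strip \<open>U\<close> depends on \<open>G\<close>; the number \<open>M\<close> of times and
  \<open>U\<close> fix how strongly \<open>A\<close> has to contract; then \<open>q\<close> is taken large for density and with \<open>q \<alpha>\<close>
  close to \<open>0\<close> for closeness; finally \<open>d\<close> comes from finitely many iterates of the new map.\<close>

lemma twist_step:
  assumes \<alpha>: "\<alpha> \<notin> \<rat>" and G: "fibred_homeo G G'" and e: "0 < e" and h: "0 < h"
  obtains U H H' d where "open U" "\<And>x. G (x, 0) \<in> U"
    "\<And>x y y'. (x, y) \<in> U \<Longrightarrow> (x, y') \<in> U \<Longrightarrow> dist y y' \<le> e"
    "fibred_homeo H H'"
    "\<And>z. dist (conj_shift (circle_of \<alpha>) H H' z) (conj_shift (circle_of \<alpha>) G G' z) < h"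
    "\<And>z. dist (conj_shift (- circle_of \<alpha>) H H' z) (conj_shift (- circle_of \<alpha>) G G' z) < h"
    "0 < d" 
    "\<And>f. (\<And>z. dist (f z) (conj_shift (circle_of \<alpha>) H H' z) \<le> d) \<Longrightarrow> almost_minimal e f \<and> almost_carries e U f"
proof -
  define a where "a = circle_of \<alpha>"
  note GD = fibred_homeoD[OF G]
  obtain M :: nat where M: "0 < M" "1 / real M \<le> e"
  proof -
    obtain n where "inverse (real (Suc n)) < e" using reals_Archimedean[OF e] by blast
    then show ?thesis by (intro that[of "Suc n"]) (auto simp: inverse_eq_divide)
  qed
  have e2: "0 < e / 2" using e by simp
  obtain s where s: "0 < s" "\<And>z w. dist z w < s \<Longrightarrow> dist (G z) (G w) < e / 2"
    using torus_uniformly_continuous[OF GD(1) e2] by blast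
  \<comment> \<open>The strip of half-width \<open>\<rho>\<close> has fibres of diameter less than \<open>s\<close>, which \<open>G\<close> maps to short ones.\<close>
  define \<rho> where "\<rho> = s / 2"
  have \<rho>: "0 < \<rho>" "s = 2 * \<rho>" using s by (simp_all add: \<rho>_def)
  define U where "U = {z. dist (snd (G' z)) 0 < \<rho>}"
  have "open U"
    unfolding U_def by (intro open_Collect_less continuous_intros GD)
  have GU: "G (x, 0) \<in> U" for x using \<rho> by (simp add: U_def GD)
  have thin: "dist y y' \<le> e" if U: "(x, y) \<in> U" "(x, y') \<in> U" for x y y'
  proof -
    obtain c where c: "G' (x, y) = (x, c)" using GD(6)[of "(x, y)"] by (metis fst_conv prod.collapse)
    obtain c' where c': "G' (x, y') = (x, c')" using GD(6)[of "(x, y')"] by (metis fst_conv prod.collapse)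
    have "dist c c' < s"
      using U dist_triangle_less_add[of c 0 \<rho> c' \<rho>] by (simp add: U_def c c' \<rho>(2))
    then have "dist (G (x, c)) (G (x, c')) < e / 2" by (intro s(2)) simp
    moreover have "G (x, c) = (x, y)" "G (x, c') = (x, y')" by (metis GD(4) c, metis GD(4) c')
    ultimately show ?thesis using e by simp
  qed
  \<comment> \<open>Contraction into the strip of half-width \<open>\<rho> / 2\<close> leaves room for perturbing the map; the
    exceptional arc is open of length \<open>2 c\<close>, which is at most the gap between the positions at the
    \<open>M\<close> times chosen below.\<close>
  define c where "c = min (\<rho> / 3) (1 / (4 * real M))"
  have c: "0 < c" "c \<le> 1" "c < \<rho> / 2" "2 * c \<le> 1 / (2 * real M)"
  proof -
    show "0 < c" using \<rho> M by (auto simp: c_def)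
    have "1 / (4 * real M) \<le> 1" using M by (simp add: field_simps)
    then show "c \<le> 1" by (simp add: c_def min.coboundedI2)
    have "c \<le> \<rho> / 3" "c \<le> 1 / (4 * real M)" by (auto simp: c_def)
    then show "c < \<rho> / 2" "2 * c \<le> 1 / (2 * real M)" using \<rho> by auto
  qed
  define A where "A = pinch c"
  obtain A' where A: "homeomorphism UNIV UNIV A A'"
    using pinch_homeomorphism[OF c(1,2)] unfolding A_def by blast
  then have AD: "continuous_on UNIV A" "\<And>x. A (A' x) = x"
    by (auto simp: homeomorphism_def)
  obtain \<delta> where \<delta>: "0 < \<delta>" "\<And>z w. dist z w < \<delta> \<Longrightarrow> dist (G z) (G w) < h"
    using torus_uniformly_continuous[OF GD(1) h] by blast
  obtain \<delta>A where \<delta>A: "0 < \<delta>A" "\<And>u v. dist u v < \<delta>A \<Longrightarrow> dist (A u) (A v) < \<delta>"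
    using circle_uniformly_continuous[OF AD(1) \<delta>(1)] by blast
  have s4: "0 < s / 4" using s(1) by simp
  obtain \<sigma> where \<sigma>: "0 < \<sigma>" "\<And>u v. dist u v < \<sigma> \<Longrightarrow> dist (A u) (A v) < s / 4"
    using circle_uniformly_continuous[OF AD(1) s4] by blast
  obtain Q :: nat where Q: "1 / real Q < s / 4" "0 < Q"
  proof -
    obtain n where "inverse (real (Suc n)) < s / 4" using reals_Archimedean[OF s4] by blast
    then show ?thesis by (intro that[of "Suc n"]) (auto simp: inverse_eq_divide)
  qed
  obtain q where q: "Q \<le> q" "0 < q" "dist (circle_mult q a) 0 < \<delta>A"
    using rotation_almost_returns[OF \<delta>A(1)] by blast
  define K where "K = twist A q"
  define K' where "K' = untwist A' q"
  have K: "fibred_homeo K K'" unfolding K_def K'_def by (rule fibred_homeo_twist[OF A])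
  define H where "H = G \<circ> K"
  define H' where "H' = K' \<circ> G'"
  have H: "fibred_homeo H H'" unfolding H_def H'_def by (rule fibred_homeo_comp[OF G K])
  have H_eq: "H (x, y) = G (x, A (y + circle_mult q x))" for x y
    by (simp add: H_def K_def twist_def)
  have close: "dist (conj_shift b H H' z) (conj_shift b G G' z) < h"
    if "dist (circle_mult q b) 0 < \<delta>A" for b z
  proof -
    have "dist (conj_shift b K K' (G' z)) (base_shift b (G' z)) < \<delta>"
      unfolding K_def K'_def by (rule conj_shift_twist_close[OF A \<delta>A(2) that])
    from \<delta>(2)[OF this] show ?thesis by (simp add: conj_shift_def H_def H'_def)
  qed
  have q': "dist (circle_mult q (- a)) 0 < \<delta>A"
    using q(3) dist_add_right[of 0 "circle_mult q a" "- circle_mult q a"]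
    by (simp add: circle_mult_minus dist_commute)
  let ?F = "conj_shift a H H'"
  have orbit: "(?F ^^ k) (H (x, y)) = G (x + circle_mult k a, A (y + circle_mult q (x + circle_mult k a)))" for k x y
    unfolding conj_shift_funpow[OF H] by (rule H_eq)
  have q\<alpha>: "real q * \<alpha> \<notin> \<rat>"
  proof
    assume "real q * \<alpha> \<in> \<rat>"
    then have "real q * \<alpha> / real q \<in> \<rat>" by (intro Rats_divide) auto
    then show False using \<alpha> q(2) by simp
  qed
  \<comment> \<open>Every orbit of the new map is dense up to \<open>e / 2\<close>, within a uniform number of steps. Given a
    target \<open>G (x1, y1)\<close>, some \<open>x2\<close> at distance at most \<open>1 / q\<close> from \<open>x1\<close> has the right height on the
    invariant curve, and the orbit of the rotation comes close to \<open>x2\<close>.\<close>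
  define \<tau> where "\<tau> = min (s / 4) (\<sigma> / real q)"
  have \<tau>: "0 < \<tau>" using s(1) \<sigma>(1) q(2) by (simp add: \<tau>_def)
  obtain N where N: "\<And>x. \<exists>k\<le>N. dist (circle_mult k a) x < \<tau>"
    using irrational_orbit_uniformly_dense[OF \<alpha> \<tau>] unfolding a_def by blast
  have dense: "\<exists>k\<le>N. dist ((?F ^^ k) z) w < e / 2" for z w
  proof -
    obtain x y where z: "z = H (x, y)" by (metis fibred_homeoD(4)[OF H] surj_pair)
    obtain x1 y1 where w: "w = G (x1, y1)" by (metis GD(4) surj_pair)
    obtain x2 where x2: "circle_mult q x2 = A' y1 - y" "dist x2 x1 \<le> 1 / real q"
      using circle_mult_eqI[OF q(2)] by metis
    obtain k where k: "k \<le> N" "dist (circle_mult k a) (x2 - x) < \<tau>" using N by blast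
    define x3 where "x3 = x + circle_mult k a"
    have "dist x3 x2 = dist (circle_mult k a) (x2 - x)"
      using dist_add_left[of x "circle_mult k a" "x2 - x"] by (simp add: x3_def)
    then have x32: "dist x3 x2 < \<tau>" using k by simp
    have "1 / real q \<le> 1 / real Q" using q Q by (simp add: frac_le)
    then have "dist x2 x1 < s / 4" using x2(2) Q(1) by linarith
    moreover have "dist x3 x2 < s / 4" using x32 by (simp add: \<tau>_def)
    moreover have "dist x3 x1 \<le> dist x3 x2 + dist x2 x1" by (rule dist_triangle)
    ultimately have x31: "dist x3 x1 < s / 2" by linarith
    have "dist (y + circle_mult q x3) (A' y1) = dist (circle_mult q x3) (circle_mult q x2)"
      using dist_add_left[of y "circle_mult q x3" "circle_mult q x2"] by (simp add: x2)
    also have "\<dots> \<le> real q * dist x3 x2" by (rule dist_circle_mult)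
    also have "\<dots> < real q * (\<sigma> / real q)" using x32 q(2) by (intro mult_strict_left_mono) (auto simp: \<tau>_def)
    also have "\<dots> = \<sigma>" using q(2) by simp
    finally have "dist (A (y + circle_mult q x3)) y1 < s / 4"
      using \<sigma>(2) AD(2) by metis
    then have "dist (x3, A (y + circle_mult q x3)) (x1, y1) < s"
      using dist_torus_le[of x3 "A (y + circle_mult q x3)" x1 y1] x31 s(1) by linarith
    moreover have "(?F ^^ k) z = G (x3, A (y + circle_mult q x3))"
      unfolding z x3_def by (rule orbit)
    ultimately have "dist ((?F ^^ k) z) w < e / 2"
      using s(2) w by simp
    then show ?thesis using k(1) by blast
  qed
  \<comment> \<open>In the coordinate before \<open>A\<close> is applied, the orbit moves by the rotation by \<open>q \<alpha>\<close>. At the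
    times in \<open>J\<close> its positions are too far apart for two of them to be in the exceptional
    arc.\<close>
  obtain J where J: "finite J" "card J = M"
    and sep: "\<And>i j. i \<in> J \<Longrightarrow> j \<in> J \<Longrightarrow> i \<noteq> j \<Longrightarrow>
       1 / (2 * real M) \<le> dist (circle_mult i (circle_of (real q * \<alpha>))) (circle_mult j (circle_of (real q * \<alpha>)))"
    using separated_times[OF q\<alpha> M(1)] by metis
  have qa: "circle_of (real q * \<alpha>) = circle_mult q a" by (simp add: a_def circle_mult_of)
  obtain r where r: "0 < r" "\<And>z w. dist z w < r \<Longrightarrow> dist (snd (G' z)) (snd (G' w)) < \<rho> / 2"
    using torus_uniformly_continuous[of "\<lambda>z. snd (G' z)" "\<rho> / 2"] \<rho>(1) GD(2)
    by (metis continuous_on_snd half_gt_zero)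
  define N' where "N' = Max (insert N J)"
  have N': "N \<le> N'" "\<And>j. j \<in> J \<Longrightarrow> j \<le> N'" using J(1) by (auto simp: N'_def)
  have re: "0 < min r (e / 2)" using r(1) e by simp
  obtain d where d: "0 < d" "\<And>f k z. (\<And>z. dist (f z) (?F z) \<le> d) \<Longrightarrow> k \<le> N' \<Longrightarrow>
      dist ((f ^^ k) z) ((?F ^^ k) z) < min r (e / 2)"
    using iterates_close[OF compact_UNIV_torus continuous_on_conj_shift[OF H] re, of a N'] by metis
  have good: "almost_minimal e f \<and> almost_carries e U f" if f: "\<And>z. dist (f z) (?F z) \<le> d" for f
  proof
    show "almost_minimal e f"
      unfolding almost_minimal_def
    proof (intro allI)
      fix z w
      obtain k where k: "k \<le> N" "dist ((?F ^^ k) z) w < e / 2" using dense by blast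
      have "dist ((f ^^ k) z) ((?F ^^ k) z) < e / 2" using d(2)[OF f, of k z] k(1) N'(1) by simp
      then have "dist ((f ^^ k) z) w < e"
        using k(2) dist_triangle[of "(f ^^ k) z" w "(?F ^^ k) z"] by linarith
      then show "\<exists>k. dist ((f ^^ k) z) w < e" by blast
    qed
    show "almost_carries e U f"
      unfolding almost_carries_def
    proof (intro allI impI)
      fix \<mu> assume \<mu>: "invariant_prob f \<mu>"
      have bad: "dist (y + circle_mult q x + circle_mult j (circle_mult q a)) 0 < c"
        if "j \<in> J" "(f ^^ j) (H (x, y)) \<in> - U" for j x y
      proof (rule ccontr)
        define t where "t = y + circle_mult q x + circle_mult j (circle_mult q a)"
        assume "\<not> dist (y + circle_mult q x + circle_mult j (circle_mult q a)) 0 < c"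
        then have "dist (A t) 0 \<le> c"
          unfolding A_def t_def by (intro dist_pinch_le c) simp
        moreover have "snd (G' ((?F ^^ j) (H (x, y)))) = A t"
          unfolding orbit GD t_def
          by (simp add: circle_mult_add add_ac circle_mult_mult[of q])
        moreover have "dist (snd (G' ((f ^^ j) (H (x, y))))) (snd (G' ((?F ^^ j) (H (x, y))))) < \<rho> / 2"
          using d(2)[OF f N'(2)[OF that(1)]] by (intro r(2)) simp
        ultimately have "dist (snd (G' ((f ^^ j) (H (x, y))))) 0 < \<rho>"
          using c(3) dist_triangle[of "snd (G' ((f ^^ j) (H (x, y))))" 0 "A t"] by simp
        then show False using that(2) by (simp add: U_def)
      qed
      have "measure \<mu> (- U) \<le> 1 / real (card J)"
      proof (rule measure_visited_at_disjoint_times[OF \<mu> _ J(1)])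
        show "- U \<in> sets borel" using \<open>open U\<close> by auto
        show "J \<noteq> {}" using J M by auto
        fix i j z assume ij: "i \<in> J" "j \<in> J" "(f ^^ i) z \<in> - U" "(f ^^ j) z \<in> - U"
        obtain x y where z: "z = H (x, y)" by (metis fibred_homeoD(4)[OF H] surj_pair)
        let ?u = "y + circle_mult q x" and ?b = "circle_mult q a"
        have "dist (circle_mult i ?b) (circle_mult j ?b) = dist (?u + circle_mult i ?b) (?u + circle_mult j ?b)"
          by simp
        also have "\<dots> \<le> dist (?u + circle_mult i ?b) 0 + dist (?u + circle_mult j ?b) 0"
          by (rule dist_triangle2)
        also have "\<dots> < 1 / (2 * real M)"
          using bad[of i x y] bad[of j x y] ij c(4) by (simp add: z)
        finally show "i = j" using sep[OF ij(1,2)] unfolding qa by force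
      qed
      then show "measure \<mu> (- U) \<le> e" using J M by simp
    qed
  qed
  show ?thesis
    by (rule that[OF \<open>open U\<close> GU thin H _ _ d(1)])
      (use close[OF q(3)] close[OF q'] good in \<open>auto simp: a_def\<close>)
qed

section \<open>Passing to the limit\<close>

lemma halving_null:
  fixes d :: "nat \<Rightarrow> real"
  assumes d: "\<And>n. 0 < d n" "\<And>n. d (Suc n) \<le> d n / 2"
  shows "d \<longlonglongrightarrow> 0"
proof -
  have d_le: "d n \<le> d 0 * (1 / 2) ^ n" for n
  proof (induction n)
    case (Suc n)
    then show ?case using d(2)[of n] by simp
  qed simp
  have "(\<lambda>n. d 0 * (1 / 2) ^ n) \<longlonglongrightarrow> d 0 * 0"
    by (intro tendsto_intros LIMSEQ_power_zero) simp
  then show ?thesis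
    by (intro tendsto_sandwich[OF _ _ tendsto_const, of 0 d sequentially "\<lambda>n. d 0 * (1 / 2) ^ n"])
      (use d d_le in \<open>auto simp: less_imp_le\<close>)
qed

text \<open>The jump from \<open>F n\<close> to \<open>F (Suc n)\<close> uses at most half of the budget \<open>d n\<close>, and the next budget
  fits in the other half; hence the limit stays within \<open>d n\<close> of \<open>F n\<close> for every \<open>n\<close>, also when
  \<open>d (Suc n)\<close> is chosen only after \<open>F (Suc n)\<close> is known.\<close>

lemma geometric_uniform_limit:
  fixes F :: "nat \<Rightarrow> 'b \<Rightarrow> 'a :: metric_space"
  assumes "compact (UNIV :: 'a set)"
    and step: "\<And>n z. dist (F (Suc n) z) (F n z) \<le> d n / 2"
    and d: "\<And>n. 0 < d n" "\<And>n. d (Suc n) \<le> d n / 2"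
  obtains f where "\<And>n z. dist (f z) (F n z) \<le> d n" "\<And>z. (\<lambda>n. F n z) \<longlonglongrightarrow> f z"
proof -
  have bound: "dist (F (n + k) z) (F n z) \<le> d n - d (n + k)" for n k z
  proof (induction k)
    case (Suc k)
    have "dist (F (n + Suc k) z) (F n z) \<le> dist (F (Suc (n + k)) z) (F (n + k) z) + dist (F (n + k) z) (F n z)"
      using dist_triangle by simp
    then show ?case using Suc step[of "n + k" z] d(2)[of "n + k"] by simp
  qed simp
  have d0: "d \<longlonglongrightarrow> 0" using d by (rule halving_null)
  have "\<exists>l. (\<lambda>n. F n z) \<longlonglongrightarrow> l" for z
  proof -
    have "Cauchy (\<lambda>n. F n z)"
      unfolding Cauchy_altdef2
    proof (intro allI impI)
      fix e :: real assume "0 < e"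
      then have "\<forall>\<^sub>F n in sequentially. d n < e" using d0 by (intro order_tendstoD(2))
      then obtain N where N: "d N < e" by (auto simp: eventually_sequentially)
      have "dist (F n z) (F N z) < e" if "n \<ge> N" for n
        using bound[of N "n - N" z] that N d(1)[of n] by simp
      then show "\<exists>N. \<forall>n\<ge>N. dist (F n z) (F N z) < e" by blast
    qed
    then show ?thesis
      using compact_imp_complete[OF assms(1)] unfolding complete_def by (metis UNIV_I)
  qed
  then obtain f where f: "\<And>z. (\<lambda>n. F n z) \<longlonglongrightarrow> f z" by metis
  have "dist (f z) (F n z) \<le> d n" for n z
  proof (rule LIMSEQ_le_const2)
    show "(\<lambda>m. dist (F m z) (F n z)) \<longlonglongrightarrow> dist (f z) (F n z)"
      by (intro tendsto_intros f)
    have "dist (F m z) (F n z) \<le> d n" if "m \<ge> n" for m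
      using bound[of n "m - n" z] that d(1)[of m] by simp
    then show "\<exists>N. \<forall>m\<ge>N. dist (F m z) (F n z) \<le> d n" by blast
  qed
  then show ?thesis using f by (rule that)
qed

lemma tendsto_of_dist_le:
  fixes u v :: "nat \<Rightarrow> 'a :: metric_space"
  assumes "\<And>n. dist (u n) (v n) \<le> d n" "d \<longlonglongrightarrow> 0" "v \<longlonglongrightarrow> l"
  shows "u \<longlonglongrightarrow> l"
proof -
  have "(\<lambda>n. d n + dist (v n) l) \<longlonglongrightarrow> 0 + 0"
    using assms(2) assms(3)[unfolded tendsto_dist_iff[of v l]] by (rule tendsto_add)
  moreover have "dist (u n) l \<le> d n + dist (v n) l" for n
    using assms(1)[of n] dist_triangle[of "u n" l "v n"] by linarith
  ultimately have "(\<lambda>n. dist (u n) l) \<longlonglongrightarrow> 0"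
    by (intro tendsto_sandwich[OF _ _ tendsto_const, of 0 "\<lambda>n. dist (u n) l" sequentially "\<lambda>n. d n + dist (v n) l"])
      auto
  then show ?thesis unfolding tendsto_dist_iff[of u l] .
qed

lemma uniform_limit_continuous:
  fixes H :: "nat \<Rightarrow> 'a :: topological_space \<Rightarrow> 'b :: metric_space"
  assumes cont: "\<And>n. continuous_on UNIV (H n)"
    and close: "\<And>n z. dist (h z) (H n z) \<le> d n" and d: "d \<longlonglongrightarrow> 0"
  shows "continuous_on UNIV h"
proof -
  have "uniform_limit UNIV H h sequentially"
  proof (rule uniform_limitI)
    fix e :: real assume "0 < e"
    then have "\<forall>\<^sub>F n in sequentially. d n < e" using d by (intro order_tendstoD(2))
    then show "\<forall>\<^sub>F n in sequentially. \<forall>x\<in>UNIV. dist (H n x) (h x) < e"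
      by (rule eventually_mono) (metis dist_commute le_less_trans close)
  qed
  with cont show ?thesis by (intro uniform_limit_theorem[where f = H]) auto
qed

text \<open>A uniform limit of homeomorphisms may collapse points. It cannot if the inverses
  converge uniformly as well, which is why both directions are controlled in the construction.\<close>

lemma homeomorphism_uniform_limit:
  fixes F B :: "nat \<Rightarrow> 'a :: metric_space \<Rightarrow> 'a"
  assumes cont: "\<And>n. continuous_on UNIV (F n)" "\<And>n. continuous_on UNIV (B n)"
    and inv: "\<And>n z. B n (F n z) = z" "\<And>n z. F n (B n z) = z"
    and f: "\<And>n z. dist (f z) (F n z) \<le> d n" and g: "\<And>n z. dist (g z) (B n z) \<le> d n"
    and d: "d \<longlonglongrightarrow> 0"
  shows "homeomorphism UNIV UNIV f g"
proof -
  have f_cont: "continuous_on UNIV f" by (rule uniform_limit_continuous[OF cont(1) f d])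
  have g_cont: "continuous_on UNIV g" by (rule uniform_limit_continuous[OF cont(2) g d])
  have lim: "(\<lambda>n. F n z) \<longlonglongrightarrow> f z" "(\<lambda>n. B n z) \<longlonglongrightarrow> g z" for z
    by (rule tendsto_of_dist_le[OF _ d tendsto_const], metis dist_commute f,
        rule tendsto_of_dist_le[OF _ d tendsto_const], metis dist_commute g)
  have gf: "g (f z) = z" for z
  proof (rule LIMSEQ_unique)
    show "(\<lambda>n. g (F n z)) \<longlonglongrightarrow> g (f z)"
      by (rule continuous_on_tendsto_compose[OF g_cont lim(1)]) auto
    show "(\<lambda>n. g (F n z)) \<longlonglongrightarrow> z"
      by (rule tendsto_of_dist_le[OF _ d tendsto_const]) (metis inv(1) g)
  qed
  have fg: "f (g z) = z" for z
  proof (rule LIMSEQ_unique)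
    show "(\<lambda>n. f (B n z)) \<longlonglongrightarrow> f (g z)"
      by (rule continuous_on_tendsto_compose[OF f_cont lim(2)]) auto
    show "(\<lambda>n. f (B n z)) \<longlonglongrightarrow> z"
      by (rule tendsto_of_dist_le[OF _ d tendsto_const]) (metis inv(2) f)
  qed
  show ?thesis using f_cont g_cont gf fg by (auto intro!: homeomorphismI)
qed

text \<open>The last clause is stated for all maps within \<open>d (Suc n)\<close> of the conjugate of index \<open>Suc n\<close>
  because the limit is going to be one of them, for every \<open>n\<close>.\<close>

lemma twist_sequence:
  assumes \<alpha>: "\<alpha> \<notin> \<rat>"
  obtains G G' U d where
    "\<And>n. fibred_homeo (G n) (G' n)" "\<And>n. 0 < d n" "\<And>n. d (Suc n) \<le> d n / 2"
    "\<And>n. open (U n)" "\<And>n x. G n (x, 0) \<in> U n"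
    "\<And>n x y y'. (x, y) \<in> U n \<Longrightarrow> (x, y') \<in> U n \<Longrightarrow> dist y y' \<le> (1 / 2) ^ n"
    "\<And>n z. dist (conj_shift (circle_of \<alpha>) (G (Suc n)) (G' (Suc n)) z)
        (conj_shift (circle_of \<alpha>) (G n) (G' n) z) \<le> d n / 2"
    "\<And>n z. dist (conj_shift (- circle_of \<alpha>) (G (Suc n)) (G' (Suc n)) z)
        (conj_shift (- circle_of \<alpha>) (G n) (G' n) z) \<le> d n / 2"
    "\<And>n f. (\<And>z. dist (f z) (conj_shift (circle_of \<alpha>) (G (Suc n)) (G' (Suc n)) z) \<le> d (Suc n)) \<Longrightarrow>
        almost_minimal ((1 / 2) ^ n) f \<and> almost_carries ((1 / 2) ^ n) (U n) f"
proof -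
  let ?a = "circle_of \<alpha>"
  define P :: "nat \<Rightarrow> (torus \<Rightarrow> torus) \<times> (torus \<Rightarrow> torus) \<times> torus set \<times> real \<Rightarrow> bool"
    where "P = (\<lambda>n (G, G', U, d). fibred_homeo G G' \<and> 0 < d)"
  define Q :: "nat \<Rightarrow> (torus \<Rightarrow> torus) \<times> (torus \<Rightarrow> torus) \<times> torus set \<times> real
      \<Rightarrow> (torus \<Rightarrow> torus) \<times> (torus \<Rightarrow> torus) \<times> torus set \<times> real \<Rightarrow> bool"
    where "Q = (\<lambda>n (G, G', U0, d) (H, H', U, d').
      d' \<le> d / 2 \<and> open U \<and> (\<forall>x. G (x, 0) \<in> U) \<and>
      (\<forall>x y y'. (x, y) \<in> U \<longrightarrow> (x, y') \<in> U \<longrightarrow> dist y y' \<le> (1 / 2) ^ n) \<and>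
      (\<forall>z. dist (conj_shift ?a H H' z) (conj_shift ?a G G' z) \<le> d / 2) \<and>
      (\<forall>z. dist (conj_shift (- ?a) H H' z) (conj_shift (- ?a) G G' z) \<le> d / 2) \<and>
      (\<forall>f. (\<forall>z. dist (f z) (conj_shift ?a H H' z) \<le> d') \<longrightarrow>
        almost_minimal ((1 / 2) ^ n) f \<and> almost_carries ((1 / 2) ^ n) U f))"
  \<comment> \<open>The set stored in a state belongs to the step leading to it, so the initial one is arbitrary.\<close>
  have "P 0 (id, id, UNIV, 1)" by (simp add: P_def fibred_homeo_id)
  then have base: "\<exists>s. P 0 s" by blast
  have step: "\<exists>s'. P (Suc n) s' \<and> Q n s s'" if "P n s" for s n
  proof -
    obtain G G' U0 d where s: "s = (G, G', U0, d)" by (cases s) auto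
    have G: "fibred_homeo G G'" and d: "0 < d / 2" using that by (auto simp: s P_def)
    have e: "(0 :: real) < (1 / 2) ^ n" by simp
    obtain U H H' d' where step: "open U" "\<And>x. G (x, 0) \<in> U"
      "\<And>x y y'. (x, y) \<in> U \<Longrightarrow> (x, y') \<in> U \<Longrightarrow> dist y y' \<le> (1 / 2) ^ n"
      "fibred_homeo H H'"
      "\<And>z. dist (conj_shift ?a H H' z) (conj_shift ?a G G' z) < d / 2"
      "\<And>z. dist (conj_shift (- ?a) H H' z) (conj_shift (- ?a) G G' z) < d / 2"
      "0 < d'"
      "\<And>f. (\<And>z. dist (f z) (conj_shift ?a H H' z) \<le> d') \<Longrightarrow>
        almost_minimal ((1 / 2) ^ n) f \<and> almost_carries ((1 / 2) ^ n) U f"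
      by (rule twist_step[OF \<alpha> G e d]) blast
    have "P (Suc n) (H, H', U, min d' (d / 2))"
      using step(4,7) d by (simp add: P_def)
    moreover have "Q n s (H, H', U, min d' (d / 2))"
      unfolding Q_def s prod.case
    proof (intro conjI allI impI)
      show "min d' (d / 2) \<le> d / 2" by simp
      show "dist (conj_shift ?a H H' z) (conj_shift ?a G G' z) \<le> d / 2"
        "dist (conj_shift (- ?a) H H' z) (conj_shift (- ?a) G G' z) \<le> d / 2" for z
        using step(5,6)[of z] by linarith+
      fix f assume "\<forall>z. dist (f z) (conj_shift ?a H H' z) \<le> min d' (d / 2)"
      then have "dist (f z) (conj_shift ?a H H' z) \<le> d'" for z by (meson min.boundedE)
      from step(8)[OF this]
      show "almost_minimal ((1 / 2) ^ n) f" "almost_carries ((1 / 2) ^ n) U f" by blast+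
    qed (use step(1-3) in blast)+
    ultimately show ?thesis by blast
  qed
  obtain S where S: "\<And>n. P n (S n)" "\<And>n. Q n (S n) (S (Suc n))"
    using dependent_nat_choice[of P Q, OF base step] by blast
  define G where "G n = fst (S n)" for n
  define G' where "G' n = fst (snd (S n))" for n
  define U where "U n = fst (snd (snd (S (Suc n))))" for n
  define d where "d n = snd (snd (snd (S n)))" for n
  note defs = G_def G'_def U_def d_def
  show ?thesis
  proof (rule that[of G G' d U])
    show "fibred_homeo (G n) (G' n)" "0 < d n" for n
      using S(1)[of n] by (auto simp: P_def defs split: prod.splits)
  qed (use S(2) in \<open>auto simp: Q_def defs split_beta\<close>)
qed

section \<open>Measures on graphs over the base\<close>

lemma invariant_prob_graph:
  assumes [measurable]: "\<gamma> \<in> borel_measurable borel" "f \<in> borel_measurable borel"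
    and eq: "AE x in circle_leb. f (\<gamma> x) = \<gamma> (x + circle_of \<alpha>)"
  shows "invariant_prob f (distr circle_leb borel \<gamma>)"
proof -
  interpret prob_space circle_leb by (rule prob_space_circle_leb)
  let ?\<mu> = "distr circle_leb borel \<gamma>"
  have R: "rotation \<alpha> \<in> measurable circle_leb circle_leb"
    using measurable_circle_shift[of "circle_of \<alpha>"] 
    by (simp add: rotation_eq[abs_def] cong: measurable_cong_sets)
  have "distr ?\<mu> borel f = distr circle_leb borel (\<lambda>x. f (\<gamma> x))"
    by (subst distr_distr) (auto simp: comp_def)
  also have "\<dots> = distr circle_leb borel (\<lambda>x. \<gamma> (x + circle_of \<alpha>))"
    by (rule distr_cong_AE) (use eq in auto)
  also have "\<dots> = distr (distr circle_leb circle_leb (rotation \<alpha>)) borel \<gamma>"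
    by (subst distr_distr) (use R in \<open>auto simp: comp_def rotation_eq\<close>)
  also have "\<dots> = ?\<mu>" by (simp add: distr_circle_leb_rotation)
  finally have "distr ?\<mu> borel f = ?\<mu>" .
  moreover have "distr ?\<mu> ?\<mu> f = distr ?\<mu> borel f" by (rule distr_cong) auto
  ultimately show ?thesis
    unfolding invariant_prob_def by (auto intro!: prob_space_distr)
qed

text \<open>The projection of an invariant measure is invariant under the irrational rotation of the
  base.\<close>

lemma fst_invariant_prob:
  fixes f :: "torus \<Rightarrow> torus"
  assumes \<alpha>: "\<alpha> \<notin> \<rat>" and f: "\<And>z. fst (f z) = fst z + circle_of \<alpha>"
    and inv: "invariant_prob f \<nu>"
  shows "distr \<nu> borel fst = circle_leb"
proof -
  from inv have \<nu>: "prob_space \<nu>" "sets \<nu> = sets borel" "f \<in> measurable \<nu> \<nu>" "distr \<nu> \<nu> f = \<nu>"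
    by (auto simp: invariant_prob_def)
  have sp: "space \<nu> = UNIV" using sets_eq_imp_space_eq[OF \<nu>(2)] by simp
  have fst_m: "fst \<in> borel_measurable \<nu>"
    unfolding measurable_cong_sets[OF \<nu>(2) refl]
    by (intro borel_measurable_continuous_onI continuous_intros)
  show ?thesis
  proof (rule irrational_rotation_uniquely_ergodic[OF _ _ _ \<alpha>])
    show "prob_space (distr \<nu> borel fst)"
      using \<nu>(1) fst_m by (rule prob_space.prob_space_distr)
    show "sets (distr \<nu> borel fst) = sets borel" by simp
    fix B :: "circle set" assume B: "B \<in> sets borel"
    then have B': "{x. x + circle_of \<alpha> \<in> B} \<in> sets borel"
      using measurable_sets[OF measurable_circle_shift B, of "circle_of \<alpha>"] by (simp add: vimage_def)
    have "emeasure (distr \<nu> borel fst) B = emeasure (distr \<nu> \<nu> f) (fst -` B)"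
      using emeasure_distr[OF fst_m B] by (simp add: sp \<nu>(4))
    also have "\<dots> = emeasure \<nu> (f -` fst -` B \<inter> space \<nu>)"
      using measurable_sets[OF fst_m B] by (intro emeasure_distr \<nu>(3)) (simp add: sp)
    also have "f -` fst -` B \<inter> space \<nu> = fst -` {x. x + circle_of \<alpha> \<in> B} \<inter> space \<nu>"
      unfolding vimage_def by (simp add: f)
    also have "emeasure \<nu> \<dots> = emeasure (distr \<nu> borel fst) {x. x + circle_of \<alpha> \<in> B}"
      by (rule emeasure_distr[OF fst_m B', symmetric])
    finally show "emeasure (distr \<nu> borel fst) {x. x + circle_of \<alpha> \<in> B} = emeasure (distr \<nu> borel fst) B"
      by simp
  qed
qed

lemma AE_eventually_in:
  assumes "prob_space M" "\<And>n. A n \<in> sets M" "\<And>n. measure M (A n) \<le> (1 / 2) ^ n"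
  shows "AE x in M. \<forall>\<^sub>F n in sequentially. x \<notin> A n"
proof -
  interpret prob_space M by fact
  have "summable (\<lambda>n. measure M (A n))"
    by (rule summable_comparison_test'[of "\<lambda>n. (1 / 2) ^ n" 0]) (use assms(3) in \<open>auto simp: summable_geometric\<close>)
  then have "AE x in M. \<forall>\<^sub>F n in sequentially. x \<in> space M - A n"
    by (intro borel_cantelli_AE1 assms(2)) (simp_all add: emeasure_eq_measure)
  then show ?thesis by (rule AE_mp) (auto elim: eventually_mono)
qed

text \<open>The isomorphism is \<open>\<gamma>\<close>, inverted by the projection. The equivariance holds only almost
  everywhere, so it is restricted to the points whose whole forward orbit stays in \<open>Y\<close>. Its image is
  measurable because it is cut out by the equation \<open>\<gamma> (fst z) = z\<close>.\<close>

lemma isomorphic_to_rotation_by_graph: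
  fixes f :: "torus \<Rightarrow> torus"
  assumes f: "homeomorphism UNIV UNIV f g"
    and inv: "invariant_prob f (distr circle_leb borel \<gamma>)"
    and \<gamma> [measurable]: "\<gamma> \<in> borel_measurable borel" and fst_\<gamma>: "\<And>x. fst (\<gamma> x) = x"
    and Y: "AE x in circle_leb. x \<in> Y" and [measurable]: "Y \<in> sets borel"
    and eq: "\<And>x. x \<in> Y \<Longrightarrow> x + circle_of \<alpha> \<in> Y \<Longrightarrow> f (\<gamma> x) = \<gamma> (x + circle_of \<alpha>)"
  shows "isomorphic_systems (distr circle_leb borel \<gamma>) f circle_leb (rotation \<alpha>)"
proof -
  let ?\<mu> = "distr circle_leb borel \<gamma>"
  interpret L: prob_space circle_leb by (rule prob_space_circle_leb)
  have fg: "continuous_on UNIV f" "continuous_on UNIV g" "\<And>z. g (f z) = z" "\<And>z. f (g z) = z"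
    using f unfolding homeomorphism_def by blast+
  have bij: "bij f" by (rule bijI') (metis fg(3), metis fg(4))
  have f_inv: "the_inv_into UNIV f = g"
    by (rule ext) (metis bij bij_is_inj fg(4) the_inv_f_f)
  have [measurable]: "f \<in> borel_measurable borel" "g \<in> borel_measurable borel"
    by (intro borel_measurable_continuous_onI fg)+
  have sys1: "measured_system ?\<mu> f"
    using inv bij by (simp add: measured_system_def invariant_prob_def f_inv cong: measurable_cong_sets)
  have R: "rotation \<beta> \<in> measurable circle_leb circle_leb" for \<beta>
    using measurable_circle_shift[of "circle_of \<beta>"]
    by (simp add: rotation_eq[abs_def] cong: measurable_cong_sets)
  have Rbij: "bij (rotation \<alpha>)"
    by (rule bijI') (auto simp: rotation_eq intro: exI[of _ "_ - circle_of \<alpha>"])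
  have R_inv: "the_inv_into UNIV (rotation \<alpha>) = rotation (- \<alpha>)"
  proof (rule ext)
    fix y
    have "rotation \<alpha> (rotation (- \<alpha>) y) = y" by (simp add: rotation_eq circle_of_minus)
    then show "the_inv_into UNIV (rotation \<alpha>) y = rotation (- \<alpha>) y"
      by (metis Rbij bij_is_inj the_inv_f_f)
  qed
  have sys2: "measured_system circle_leb (rotation \<alpha>)"
    unfolding measured_system_def space_circle_leb R_inv
    using prob_space_circle_leb R Rbij distr_circle_leb_rotation by blast
  define Y0 where "Y0 = {x. \<forall>k. x + circle_mult k (circle_of \<alpha>) \<in> Y}"
  have shift_sets: "{x. x + c \<in> B} \<in> sets borel" if "B \<in> sets borel" for B and c :: circle
    using measurable_sets[OF measurable_circle_shift that, of c] by (simp add: vimage_def)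
  have Y0_meas [measurable]: "Y0 \<in> sets borel"
  proof -
    have "Y0 = (\<Inter>k. {x. x + circle_mult k (circle_of \<alpha>) \<in> Y})" by (auto simp: Y0_def)
    then show ?thesis using shift_sets[of Y] by auto
  qed
  have "AE x in circle_leb. x + c \<in> Y" for c
    by (rule AE_circle_leb_shift[OF Y]) measurable
  then have "AE x in circle_leb. x \<in> Y0"
    by (simp add: Y0_def AE_all_countable)
  then have Y0_1: "emeasure circle_leb Y0 = 1"
    using L.emeasure_eq_1_AE by simp
  have Y0_step: "rotation \<alpha> x \<in> Y0 \<and> \<gamma> (rotation \<alpha> x) = f (\<gamma> x)" if "x \<in> Y0" for x
  proof -
    have k: "x + circle_mult k (circle_of \<alpha>) \<in> Y" for k using that by (simp add: Y0_def)
    have "x + circle_of \<alpha> + circle_mult k (circle_of \<alpha>) \<in> Y" for k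
      using k[of "Suc k"] by (simp add: circle_mult_Suc add_ac)
    moreover have "f (\<gamma> x) = \<gamma> (x + circle_of \<alpha>)"
      using k[of 0] k[of 1] by (intro eq) (simp_all add: circle_mult_Suc)
    ultimately show ?thesis by (simp add: Y0_def rotation_eq)
  qed
  define X0 where "X0 = {z :: torus. fst z \<in> Y0 \<and> \<gamma> (fst z) = z}"
  have fst_m [measurable]: "fst \<in> borel_measurable (borel :: torus measure)"
    by (intro borel_measurable_continuous_onI continuous_intros)
  have X0_meas [measurable]: "X0 \<in> sets borel"
  proof -
    have "X0 = {z \<in> space borel. fst z \<in> Y0 \<and> dist (\<gamma> (fst z)) z = 0}"
      by (auto simp: X0_def)
    also have "\<dots> \<in> sets borel" by measurable
    finally show ?thesis .
  qed
  have \<gamma>_X0: "\<gamma> x \<in> X0 \<longleftrightarrow> x \<in> Y0" for x by (simp add: X0_def fst_\<gamma>)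
  have X0_1: "emeasure ?\<mu> X0 = 1"
    by (subst emeasure_distr) (auto simp: vimage_def \<gamma>_X0 Y0_1)
  have bij0: "bij_betw \<gamma> Y0 X0"
    by (rule bij_betw_byWitness[where f' = fst]) (auto simp: X0_def fst_\<gamma>)
  have \<gamma>0: "\<gamma> \<in> measurable (restrict_space circle_leb Y0) (restrict_space ?\<mu> X0)"
    by (rule measurable_restrict_space3) (auto simp: \<gamma>_X0 cong: measurable_cong_sets)
  have inv_eq: "the_inv_into Y0 \<gamma> z = fst z" if "z \<in> X0" for z
  proof (rule the_inv_into_f_eq)
    show "inj_on \<gamma> Y0" using bij0 by (rule bij_betw_imp_inj_on)
  qed (use that in \<open>auto simp: X0_def\<close>)
  have "fst \<in> measurable (restrict_space ?\<mu> X0) (restrict_space circle_leb Y0)"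
    by (rule measurable_restrict_space3) (auto simp: X0_def cong: measurable_cong_sets)
  then have inv0: "the_inv_into Y0 \<gamma> \<in> measurable (restrict_space ?\<mu> X0) (restrict_space circle_leb Y0)"
    by (subst measurable_cong[of _ _ fst]) (auto simp: space_restrict_space inv_eq)
  have "distr (restrict_space circle_leb Y0) (restrict_space ?\<mu> X0) \<gamma> = restrict_space ?\<mu> X0"
  proof (rule measure_eqI)
    fix B assume "B \<in> sets (distr (restrict_space circle_leb Y0) (restrict_space ?\<mu> X0) \<gamma>)"
    then have B: "B \<in> sets (restrict_space ?\<mu> X0)" by simp
    then have B': "B \<in> sets borel" "B \<subseteq> X0"
      by (auto simp: sets_restrict_space_iff)
    have "emeasure (distr (restrict_space circle_leb Y0) (restrict_space ?\<mu> X0) \<gamma>) B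
        = emeasure (restrict_space circle_leb Y0) (\<gamma> -` B \<inter> Y0)"
      by (subst emeasure_distr[OF \<gamma>0 B]) (simp add: space_restrict_space)
    also have "\<dots> = emeasure circle_leb (\<gamma> -` B)"
    proof -
      have "\<gamma> -` B \<inter> Y0 = \<gamma> -` B" using B'(2) \<gamma>_X0 by blast
      moreover have "emeasure (restrict_space circle_leb Y0) (\<gamma> -` B \<inter> Y0) = emeasure circle_leb (\<gamma> -` B \<inter> Y0)"
        using Y0_meas by (intro emeasure_restrict_space) auto
      ultimately show ?thesis by simp
    qed
    also have "\<dots> = emeasure ?\<mu> B" using B'(1) by (simp add: emeasure_distr)
    also have "\<dots> = emeasure (restrict_space ?\<mu> X0) B"
      using B'(2) by (simp add: emeasure_restrict_space)
    finally show "emeasure (distr (restrict_space circle_leb Y0) (restrict_space ?\<mu> X0) \<gamma>) B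
        = emeasure (restrict_space ?\<mu> X0) B" .
  qed simp
  then show ?thesis
    unfolding isomorphic_systems_def
    using sys1 sys2 X0_1 Y0_1 bij0 \<gamma>0 inv0 Y0_step
    by (intro conjI exI[of _ X0] exI[of _ Y0] exI[of _ \<gamma>]) auto
qed

section \<open>The minimal uniquely ergodic homeomorphism\<close>

theorem theorem2:
  fixes \<alpha> :: real
  assumes "\<alpha> \<notin> \<rat>"
  shows "\<exists>(f :: torus \<Rightarrow> torus) (\<mu> :: torus measure).
           minimal_homeomorphism f \<and> uniquely_ergodic f \<and> invariant_prob f \<mu> \<and>
           isomorphic_systems \<mu> f circle_leb (rotation \<alpha>)"
proof -
  obtain G G' U d where
    G: "\<And>n. fibred_homeo (G n) (G' n)" and d: "\<And>n. 0 < d n" "\<And>n. d (Suc n) \<le> d n / 2"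
    and U: "\<And>n. open (U n)" and GU: "\<And>n x. G n (x, 0) \<in> U n"
    and thin: "\<And>n x y y'. (x, y) \<in> U n \<Longrightarrow> (x, y') \<in> U n \<Longrightarrow> dist y y' \<le> (1 / 2) ^ n"
    and F_step: "\<And>n z. dist (conj_shift (circle_of \<alpha>) (G (Suc n)) (G' (Suc n)) z)
        (conj_shift (circle_of \<alpha>) (G n) (G' n) z) \<le> d n / 2"
    and B_step: "\<And>n z. dist (conj_shift (- circle_of \<alpha>) (G (Suc n)) (G' (Suc n)) z)
        (conj_shift (- circle_of \<alpha>) (G n) (G' n) z) \<le> d n / 2"
    and good: "\<And>n f. (\<And>z. dist (f z) (conj_shift (circle_of \<alpha>) (G (Suc n)) (G' (Suc n)) z) \<le> d (Suc n)) \<Longrightarrow>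
        almost_minimal ((1 / 2) ^ n) f \<and> almost_carries ((1 / 2) ^ n) (U n) f"
    by (rule twist_sequence[OF assms]) blast
  define a where "a = circle_of \<alpha>"
  define F where "F n = conj_shift a (G n) (G' n)" for n
  define B where "B n = conj_shift (- a) (G n) (G' n)" for n
  obtain f where f: "\<And>n z. dist (f z) (F n z) \<le> d n" "\<And>z. (\<lambda>n. F n z) \<longlonglongrightarrow> f z"
    using geometric_uniform_limit[OF compact_UNIV_torus, of F d] F_step d
    unfolding F_def a_def by metis
  obtain g where g: "\<And>n z. dist (g z) (B n z) \<le> d n" "\<And>z. (\<lambda>n. B n z) \<longlonglongrightarrow> g z"
    using geometric_uniform_limit[OF compact_UNIV_torus, of B d] B_step d
    unfolding B_def a_def by metis
  have d0: "d \<longlonglongrightarrow> 0" using d by (rule halving_null)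
  have FB_cont: "continuous_on UNIV (F n)" "continuous_on UNIV (B n)" for n
    unfolding F_def B_def by (rule continuous_on_conj_shift[OF G])+
  have BF: "B n (F n z) = z" "F n (B n z) = z" for n z
    using conj_shift_inverse[OF G, of a n z] conj_shift_inverse[OF G, of "- a" n z]
    by (simp_all add: F_def B_def)
  have homeo: "homeomorphism UNIV UNIV f g"
    by (rule homeomorphism_uniform_limit[OF FB_cont BF f(1) g(1) d0])
  then have f_cont: "continuous_on UNIV f" by (simp add: homeomorphism_def)
  have fst_f: "fst (f z) = fst z + a" for z
  proof -
    have "(\<lambda>n. fst (F n z)) \<longlonglongrightarrow> fst (f z)" by (intro tendsto_fst f(2))
    then show ?thesis by (simp add: F_def fst_conj_shift[OF G] LIMSEQ_const_iff)
  qed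
  have almost: "almost_minimal ((1 / 2) ^ n) f" "almost_carries ((1 / 2) ^ n) (U n) f" for n
    using good[of f n] f(1)[of _ "Suc n"] by (auto simp: F_def a_def)
  have "minimal_homeomorphism f"
    unfolding minimal_homeomorphism_def
  proof (intro conjI allI)
    show "\<exists>g. homeomorphism UNIV UNIV f g" using homeo by blast
    fix z
    have "w \<in> closure (full_orbit f z)" for w
      unfolding closure_approachable
    proof (intro allI impI)
      fix e :: real assume "0 < e"
      then obtain n where n: "(1 / 2) ^ n < e" using real_arch_pow_inv[of e "1 / 2"] by auto
      obtain k where "dist ((f ^^ k) z) w < (1 / 2) ^ n"
        using almost(1)[of n] unfolding almost_minimal_def by blast
      then show "\<exists>y\<in>full_orbit f z. dist y w < e"
        using n by (intro bexI[of _ "(f ^^ k) z"]) (auto simp: full_orbit_def)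
    qed
    then show "closure (full_orbit f z) = UNIV" by blast
  qed
  \<comment> \<open>The curves \<open>c n\<close> are invariant under \<open>F n\<close>, and their almost sure limit is the graph carrying
    the invariant measure.\<close>
  define c where "c n x = G n (x, 0)" for n x
  have c_cont: "continuous_on UNIV (c n)" for n
    unfolding c_def[abs_def]
    by (rule continuous_on_compose2[OF fibred_homeoD(1)[OF G]]) (auto intro!: continuous_intros)
  have c_meas [measurable]: "c n \<in> borel_measurable borel" for n
    by (intro borel_measurable_continuous_onI c_cont)
  have f_meas [measurable]: "f \<in> borel_measurable borel"
    by (intro borel_measurable_continuous_onI f_cont)
  have F_meas [measurable]: "F n \<in> borel_measurable borel" for n
    unfolding F_def by (intro borel_measurable_continuous_onI continuous_on_conj_shift[OF G])
  have U_meas [measurable]: "U n \<in> sets borel" for n using U by simp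
  have fst_c: "fst (c n x) = x" for n x by (simp add: c_def fibred_homeoD[OF G])
  have Fc: "F n (c n x) = c n (x + a)" for n x
    by (simp add: F_def c_def conj_shift_G[OF G])
  have thin': "dist z w \<le> (1 / 2) ^ n" if "z \<in> U n" "w \<in> U n" "fst z = fst w" for z w n
    using thin[of "fst z" "snd z" n "snd w"] that
    by (metis dist_torus_same_fibre prod.collapse)
  \<comment> \<open>Both \<open>c n x\<close> and, for almost every \<open>x\<close> and large \<open>n\<close>, its successor lie in the thin set
    \<open>U n\<close>; this makes the sequence \<open>c n x\<close> Cauchy.\<close>
  define Y where "Y = {x. \<forall>\<^sub>F n in sequentially. c (Suc n) x \<in> U n}"
  have Y_meas [measurable]: "Y \<in> sets borel"
    unfolding Y_def eventually_sequentially by measurable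
  have Y_AE: "AE x in circle_leb. x \<in> Y"
  proof -
    have "AE x in circle_leb. \<forall>\<^sub>F n in sequentially. x \<notin> c (Suc n) -` (- U n)"
    proof (rule AE_eventually_in[OF prob_space_circle_leb])
      fix n
      have m: "c (Suc n) -` (- U n) \<in> sets borel"
        using measurable_sets[OF c_meas, of "- U n" "Suc n"] by simp
      then show "c (Suc n) -` (- U n) \<in> sets circle_leb" by simp
      have "invariant_prob (F (Suc n)) (distr circle_leb borel (c (Suc n)))"
        by (rule invariant_prob_graph) (auto simp: Fc a_def)
      moreover have "almost_carries ((1 / 2) ^ n) (U n) (F (Suc n))"
        using good[of "F (Suc n)" n] d(1)[of "Suc n"] by (simp add: F_def a_def less_imp_le)
      ultimately have "measure (distr circle_leb borel (c (Suc n))) (- U n) \<le> (1 / 2) ^ n"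
        unfolding almost_carries_def by blast
      then show "measure circle_leb (c (Suc n) -` (- U n)) \<le> (1 / 2) ^ n"
        by (simp add: measure_distr)
    qed
    then show ?thesis by (simp add: Y_def)
  qed
  have conv: "\<exists>l. (\<lambda>n. c n x) \<longlonglongrightarrow> l" if "x \<in> Y" for x
  proof -
    obtain N where N: "\<And>n. n \<ge> N \<Longrightarrow> c (Suc n) x \<in> U n"
      using \<open>x \<in> Y\<close> by (auto simp: Y_def eventually_sequentially)
    have step: "dist (c (Suc n + N) x) (c (n + N) x) \<le> (2 * (1 / 2) ^ (n + N)) / 2" for n
      using thin'[of "c (Suc (n + N)) x" "n + N" "c (n + N) x"] N[of "n + N"] GU
      by (simp add: fst_c) (simp add: c_def)
    \<comment> \<open>A sequence of points is a sequence of functions on a one-point set.\<close>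
    have "\<exists>l :: unit \<Rightarrow> torus. \<forall>u. (\<lambda>n. c (n + N) x) \<longlonglongrightarrow> l u"
      by (rule geometric_uniform_limit[OF compact_UNIV_torus,
            of "\<lambda>n (_ :: unit). c (n + N) x" "\<lambda>n. 2 * (1 / 2) ^ (n + N)"])
        (use step in auto)
    then obtain l :: "unit \<Rightarrow> torus" where "(\<lambda>n. c (n + N) x) \<longlonglongrightarrow> l ()" by blast
    then have "(\<lambda>n. c n x) \<longlonglongrightarrow> l ()" by (rule LIMSEQ_offset[of "\<lambda>n. c n x" N "l ()"])
    then show ?thesis by blast
  qed
  define \<gamma> where "\<gamma> x = (if x \<in> Y then lim (\<lambda>n. c n x) else (x, 0))" for x
  have \<gamma>_lim: "(\<lambda>n. c n x) \<longlonglongrightarrow> \<gamma> x" if "x \<in> Y" for x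
    using conv[OF that] that by (auto simp: \<gamma>_def limI)
  have fst_\<gamma>: "fst (\<gamma> x) = x" for x
  proof (cases "x \<in> Y")
    case True
    have "(\<lambda>n. fst (c n x)) \<longlonglongrightarrow> fst (\<gamma> x)" by (intro tendsto_fst \<gamma>_lim True)
    then show ?thesis by (simp add: fst_c LIMSEQ_const_iff)
  qed (simp add: \<gamma>_def)
  have \<gamma>_meas [measurable]: "\<gamma> \<in> borel_measurable borel"
  proof (rule borel_measurable_LIMSEQ_metric)
    fix n
    have [measurable]: "(\<lambda>x. (x, 0) :: torus) \<in> borel_measurable borel"
      by (intro borel_measurable_continuous_onI continuous_intros)
    show "(\<lambda>x. if x \<in> Y then c n x else (x, 0)) \<in> borel_measurable borel"
      by measurable
  next
    fix x
    show "(\<lambda>n. if x \<in> Y then c n x else (x, 0)) \<longlonglongrightarrow> \<gamma> x"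
      using \<gamma>_lim[of x] by (cases "x \<in> Y") (auto simp: \<gamma>_def)
  qed
  have eq: "f (\<gamma> x) = \<gamma> (x + a)" if x: "x \<in> Y" "x + a \<in> Y" for x
  proof (rule LIMSEQ_unique[OF _ \<gamma>_lim[OF x(2)]])
    show "(\<lambda>n. c n (x + a)) \<longlonglongrightarrow> f (\<gamma> x)"
    proof (rule tendsto_of_dist_le[OF _ d0])
      show "dist (c n (x + a)) (f (c n x)) \<le> d n" for n
        by (metis Fc dist_commute f(1))
      show "(\<lambda>n. f (c n x)) \<longlonglongrightarrow> f (\<gamma> x)"
        by (rule continuous_on_tendsto_compose[OF f_cont \<gamma>_lim[OF x(1)]]) auto
    qed
  qed
  define \<mu> where "\<mu> = distr circle_leb borel \<gamma>"
  have inv: "invariant_prob f \<mu>"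
    unfolding \<mu>_def
  proof (rule invariant_prob_graph)
    have "AE x in circle_leb. x + a \<in> Y"
      by (rule AE_circle_leb_shift[OF Y_AE Y_meas])
    with Y_AE show "AE x in circle_leb. f (\<gamma> x) = \<gamma> (x + circle_of \<alpha>)"
      by eventually_elim (use eq in \<open>simp add: a_def\<close>)
  qed auto
  have unique: "\<nu> = \<mu>" if \<nu>: "invariant_prob f \<nu>" for \<nu>
  proof -
    have pr: "prob_space \<nu>" and sets: "sets \<nu> = sets borel" using \<nu> by (auto simp: invariant_prob_def)
    note [measurable_cong] = sets
    have fst_m [measurable]: "fst \<in> borel_measurable (borel :: torus measure)"
      by (intro borel_measurable_continuous_onI continuous_intros)
    have base: "distr \<nu> borel fst = circle_leb"
      by (rule fst_invariant_prob[OF assms _ \<nu>]) (simp add: fst_f a_def)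
    have "AE z in \<nu>. \<forall>\<^sub>F n in sequentially. z \<notin> - U n"
      by (rule AE_eventually_in[OF pr]) (use almost(2) \<nu> in \<open>auto simp: sets almost_carries_def\<close>)
    moreover have "AE z in \<nu>. fst z \<in> Y"
    proof -
      have "AE x in distr \<nu> borel fst. x \<in> Y" unfolding base by (rule Y_AE)
      then show ?thesis by (subst (asm) AE_distr_iff) simp_all
    qed
    \<comment> \<open>Almost every \<open>z\<close> is eventually in the same thin fibre as \<open>c n (fst z)\<close>, hence is its limit.\<close>
    ultimately have "AE z in \<nu>. \<gamma> (fst z) = z"
    proof eventually_elim
      case (elim z)
      have "(\<lambda>n. (1 / 2 :: real) ^ n) \<longlonglongrightarrow> 0" by (rule LIMSEQ_power_zero) simp
      moreover have "\<forall>\<^sub>F n in sequentially. dist (c n (fst z)) z \<le> dist ((1 / 2 :: real) ^ n) 0"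
        using elim(1)
      proof eventually_elim
        case (elim n)
        then show ?case
          using thin'[of "c n (fst z)" n z] GU[of n "fst z"] by (simp add: fst_c) (simp add: c_def)
      qed
      ultimately have "(\<lambda>n. c n (fst z)) \<longlonglongrightarrow> z"
        by (rule metric_tendsto_imp_tendsto)
      then show ?case using \<gamma>_lim[OF elim(2)] by (metis LIMSEQ_unique)
    qed
    then have "distr \<nu> borel (\<lambda>z. z) = distr \<nu> borel (\<lambda>z. \<gamma> (fst z))"
      by (intro distr_cong_AE) auto
    also have "\<dots> = distr (distr \<nu> borel fst) borel \<gamma>"
      by (subst distr_distr) (auto simp: comp_def)
    also have "\<dots> = \<mu>" by (simp add: base \<mu>_def)
    finally show ?thesis using distr_id2[OF sets[symmetric]] by simp
  qed
  have "uniquely_ergodic f"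
    unfolding uniquely_ergodic_def using inv unique by blast
  moreover have "isomorphic_systems \<mu> f circle_leb (rotation \<alpha>)"
    unfolding \<mu>_def
    by (rule isomorphic_to_rotation_by_graph[OF homeo inv[unfolded \<mu>_def] \<gamma>_meas fst_\<gamma> Y_AE Y_meas])
      (use eq in \<open>simp add: a_def\<close>)
  ultimately show ?thesis using \<open>minimal_homeomorphism f\<close> inv by blast
qed

end
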